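(* For every integer $d\geq 5$ there exist constants $c>0$ and $n_0$ such that for all $n\geq n_0$, $$\mathrm{sn}(d,n)\;\geq\; 2^{\,c\, n^{\lfloor (d-1)/2\rfloor}},$$ where $\mathrm{sn}(d,n)$ denotes the number of distinct $\lfloor d/2\rfloor$-neighborly simplicial $(d-1)$-spheres with vertex set $[n]=\{1,\dots,n\}$ (labeled vertices). That is, $\mathrm{sn}(d,n)\geq 2^{\Omega(n^{\lfloor (d-1)/2\rfloor})}$.
   Context: A simplicial complex $\Delta$ with vertex set $V$ is $i$-neighborly (w.r.t. $V$) if every subset of $V$ of size at most $i$ is a face of $\Delta$. A simplicial $(d-1)$-sphere is a simplicial complex homeomorphic to the $(d-1)$-sphere; two such spheres on vertex set $[n]$ are counted as distinct if their sets of faces differ. *)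

theory Defs
  imports "HOL-Analysis.Analysis"
begin

definition simplicial_complex_on :: "nat set \<Rightarrow> nat set set \<Rightarrow> bool" where
  "simplicial_complex_on V K \<longleftrightarrow>
     (\<forall>F\<in>K. F \<subseteq> V \<and> finite F) \<and>
     (\<forall>F\<in>K. \<forall>G. G \<subseteq> F \<longrightarrow> G \<in> K) \<and>
     (\<forall>v\<in>V. {v} \<in> K)"

definition neighborly :: "nat \<Rightarrow> nat set \<Rightarrow> nat set set \<Rightarrow> bool" where
  "neighborly i V K \<longleftrightarrow> (\<forall>S. S \<subseteq> V \<and> finite S \<and> card S \<le> i \<longrightarrow> S \<in> K)"

text \<open>Standard geometric realization: vertex j is sent to the j-th unit vector of
  nat \<Rightarrow> real; a point is a convex combination of the vertices of a face, i.e. a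
  nonnegative vector with coordinate sum 1 whose support is a face.\<close>
definition geom_realization :: "nat set set \<Rightarrow> (nat \<Rightarrow> real) set" where
  "geom_realization K = {x. (\<forall>j. 0 \<le> x j) \<and> finite {j. x j \<noteq> 0} \<and>
       (\<Sum>j\<in>{j. x j \<noteq> 0}. x j) = 1 \<and> {j. x j \<noteq> 0} \<in> K}"

definition simplicial_sphere :: "nat \<Rightarrow> nat set \<Rightarrow> nat set set \<Rightarrow> bool" where
  "simplicial_sphere d V K \<longleftrightarrow> simplicial_complex_on V K \<and>
     subtopology (powertop_real UNIV) (geom_realization K) homeomorphic_space nsphere (d - 1)"

definition sn :: "nat \<Rightarrow> nat \<Rightarrow> nat" where
  "sn d n = card {K. simplicial_sphere d {1..n} K \<and> neighborly (d div 2) {1..n} K}"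

end

theory Submission
  imports Defs
begin

text \<open>
  Bistellar flips preserve the homeomorphism type: a global piecewise linear formula realises each of
  them. All spheres are therefore produced from the boundary of a simplex by flips.

  Order the facets of a cyclic \<open>(2k+1)\<close>-sphere which are unions of \<open>k + 1\<close> pairs \<open>{i, i + 1}\<close> by the sum
  of their elements. An initial segment \<open>L\<close> of this order is a squeezed ball in the sense of Kalai, and
  enlarging \<open>L\<close> by one facet is a flip of its boundary. The facets of equal sum \<open>s\<close> are mutually
  independent: below them \<open>L\<close> may be completed by an arbitrary subset \<open>A\<close> of this layer, and \<open>A\<close> can be
  recovered from the resulting sphere. By pigeonhole some layer has of the order of \<open>n ^ k\<close> elements.

  For \<open>d = 2k + 1\<close> the boundary of \<open>L\<close> is the desired sphere. For \<open>d = 2k + 2\<close> one cones off a region of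
  the cyclic sphere from a new vertex. To keep all \<open>(k+1)\<close>-sets as faces the region has to be a thin
  slab: the facets outside \<open>L\<close> whose cyclic shift by \<open>-1\<close> lies in \<open>L\<close> (a relative squeezed ball).
\<close>

section \<open>Flips of simplicial complexes\<close>

text \<open>Topology enters only through single flips, so everything rests on a canonical splitting
  of each cell. Its \<open>upper_part\<close> lies in no other cell of the same or smaller rank, its
  \<open>lower_part\<close> in no other cell of the same or larger rank and in none of
  \<open>W\<close>. That ties are excluded is what makes the cells of a layer independent.

  Cells through 1 are ranked before all others and always kept in \<open>L\<close>. A cell
  \<open>F\<close> without 1 splits into \<open>hi F\<close> and \<open>lo F\<close>, both of size
  \<open>k + 1\<close>, so a set of at most \<open>k\<close> vertices contains neither and can be
  pushed across a ridge to a neighbouring cell. This yields \<open>k\<close>-neighborliness on both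
  sides of the hypersurface.

  For even \<open>d\<close>, coning off the whole outside of \<open>L\<close> would destroy the
  \<open>(k+1)\<close>-sets \<open>hi F\<close> of the cells \<open>F\<close> outside
  \<open>L\<close>. The shift of \<open>F\<close> by one contains \<open>hi F\<close>, because it
  carries \<open>lo F\<close> to \<open>hi F\<close>; keeping these shifted cells restores every
  lost set.

  The exponent is a quotient: the order of \<open>n ^ (k + 1)\<close> cells avoid 1, while their
  sums take only the order of \<open>n\<close> values.\<close>

lemma homeomorphic_space_powertopI:
  fixes S T :: "(nat \<Rightarrow> real) set"
  assumes "continuous_on S f" "continuous_on T g" "f ` S \<subseteq> T" "g ` T \<subseteq> S"
    and "\<And>x. x \<in> S \<Longrightarrow> g (f x) = x" "\<And>y. y \<in> T \<Longrightarrow> f (g y) = y"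
  shows "subtopology (powertop_real UNIV) S homeomorphic_space subtopology (powertop_real UNIV) T"
  unfolding homeomorphic_space_def homeomorphic_maps_def euclidean_product_topology
  by (intro exI[of _ f] exI[of _ g] conjI)
    (use assms in \<open>simp_all add: continuous_map_iff_continuous2 image_subset_iff\<close>)

lemma continuous_on_Min_image:
  fixes f :: "'i \<Rightarrow> 'a::topological_space \<Rightarrow> real"
  assumes "finite A" "A \<noteq> {}" "\<And>i. i \<in> A \<Longrightarrow> continuous_on S (f i)"
  shows "continuous_on S (\<lambda>x. Min ((\<lambda>i. f i x) ` A))"
  using assms
proof (induction A rule: finite_ne_induct)
  case (insert a A)
  have "continuous_on S (\<lambda>x. min (f a x) (Min ((\<lambda>i. f i x) ` A)))"
    using insert by (intro continuous_on_min) auto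
  then show ?case using insert by simp
qed auto

lemma continuous_on_coordinate:
  "continuous_on S (\<lambda>x :: 'i \<Rightarrow> 'b::topological_space. x i)"
  by (rule continuous_on_subset[OF continuous_on_product_coordinates]) simp

text \<open>A bistellar flip stated without purity or dimension: on the vertices
  \<open>A \<union> B\<close> the complex \<open>K\<close> is the join of \<open>A\<close> with
  \<partial>B, and \<open>K'\<close> the join of \<partial>A with \<open>B\<close>. The last two
  clauses make these joins the full stars of \<open>A\<close> in \<open>K\<close> and of
  \<open>B\<close> in \<open>K'\<close>.\<close>

definition flip :: "nat set \<Rightarrow> nat set \<Rightarrow> nat set set \<Rightarrow> nat set set \<Rightarrow> bool" where
  "flip A B K K' \<longleftrightarrow>
     finite A \<and> finite B \<and> A \<noteq> {} \<and> B \<noteq> {} \<and> A \<inter> B = {} \<and>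
     (\<forall>H. \<not> H \<subseteq> A \<union> B \<longrightarrow> (H \<in> K \<longleftrightarrow> H \<in> K')) \<and>
     (\<forall>H \<subseteq> A \<union> B. H \<in> K \<longleftrightarrow> \<not> B \<subseteq> H) \<and>
     (\<forall>H \<subseteq> A \<union> B. H \<in> K' \<longleftrightarrow> \<not> A \<subseteq> H) \<and>
     (\<forall>H\<in>K. A \<subseteq> H \<longrightarrow> H \<subseteq> A \<union> B) \<and>
     (\<forall>H\<in>K'. B \<subseteq> H \<longrightarrow> H \<subseteq> A \<union> B)"

lemma flip_sym: "flip A B K K' \<Longrightarrow> flip B A K' K"
  unfolding flip_def Un_commute[of B A] Int_commute[of B A] by (elim conjE, intro conjI) blast+

text \<open>Both \<open>A * \<partial>B\<close> and \<open>\<partial>A * B\<close> project bijectively along the line through the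
  barycentres of \<open>A\<close> and \<open>B\<close>; the map moves a point along it until a coordinate in \<open>A\<close> vanishes.
  Outside the star of \<open>A\<close> the minimum is \<open>0\<close> and nothing moves.\<close>

definition flip_map :: "nat set \<Rightarrow> nat set \<Rightarrow> (nat \<Rightarrow> real) \<Rightarrow> nat \<Rightarrow> real" where
  "flip_map A B x = (let m = Min (x ` A) in
     (\<lambda>j. if j \<in> A then x j - m else if j \<in> B then x j + real (card A) / real (card B) * m else x j))"

lemma continuous_on_flip_map:
  assumes "finite A" "A \<noteq> {}"
  shows "continuous_on S (flip_map A B)"
proof -
  have "continuous_on S (\<lambda>x. Min (x ` A))"
    using assms by (intro continuous_on_Min_image continuous_on_coordinate)
  then have "continuous_on S (\<lambda>x. x j + c * Min (x ` A))" for j c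
    by (intro continuous_on_add continuous_on_coordinate continuous_on_mult_left)
  from this this[of _ "- 1"] have "continuous_on S (\<lambda>x. flip_map A B x j)" for j
    unfolding flip_map_def Let_def
    by (cases "j \<in> A"; cases "j \<in> B")
      (simp_all add: continuous_on_coordinate del: times_divide_eq_left)
  then show ?thesis by (rule continuous_on_coordinatewise_then_product)
qed

text \<open>On every face of \<open>K\<close> some coordinate in \<open>B\<close> vanishes, so after
  the move the minimum over \<open>B\<close> is exactly the amount added there, and the reverse map
  takes it away again. A positive minimum over \<open>A\<close> means that the support contains
  \<open>A\<close>, hence lies in \<open>A \<union> B\<close>.\<close>

lemma flip_map_realization:
  assumes fl: "flip A B K K'" and x: "x \<in> geom_realization K"
  shows "flip_map A B x \<in> geom_realization K'" "flip_map B A (flip_map A B x) = x"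
proof -
  define m where "m = Min (x ` A)"
  define y where "y = flip_map A B x"
  note f = fl[unfolded flip_def, THEN conjunct2, THEN conjunct2, THEN conjunct2, THEN conjunct2, THEN conjunct2]
  note f1 = f[THEN conjunct1, rule_format]
    and f2 = f[THEN conjunct2, THEN conjunct1, rule_format]
    and f3 = f[THEN conjunct2, THEN conjunct2, THEN conjunct1, rule_format]
    and f4 = f[THEN conjunct2, THEN conjunct2, THEN conjunct2, THEN conjunct1, rule_format]
    and f5 = f[THEN conjunct2, THEN conjunct2, THEN conjunct2, THEN conjunct2, rule_format]
  have AB: "finite A" "finite B" "A \<noteq> {}" "B \<noteq> {}" "A \<inter> B = {}"
    using fl by (simp_all only: flip_def simp_thms)
  have x0: "\<And>j. 0 \<le> x j" and xf: "finite {j. x j \<noteq> 0}" and xs: "(\<Sum>j | x j \<noteq> 0. x j) = 1"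
    and xK: "{j. x j \<noteq> 0} \<in> K"
    using x by (auto simp: geom_realization_def)
  have cA: "card A > 0" and cB: "card B > 0" using AB by (auto simp: card_gt_0_iff)
  have m_le: "m \<le> x a" if "a \<in> A" for a using that AB by (simp add: m_def)
  obtain a0 where a0: "a0 \<in> A" "x a0 = m"
  proof -
    have "m \<in> x ` A" unfolding m_def using AB by (intro Min_in) auto
    then show ?thesis using that by blast
  qed
  have m0: "m \<ge> 0" using a0 x0 by metis
  have yj: "y j = (if j \<in> A then x j - m else if j \<in> B then x j + real (card A) / real (card B) * m else x j)" for j
    by (simp add: y_def flip_map_def m_def Let_def)
  have nB: "\<not> B \<subseteq> {j. x j \<noteq> 0}"
  proof (cases "{j. x j \<noteq> 0} \<subseteq> A \<union> B")
    case True then show ?thesis using f2 xK by simp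
  next
    case False
    then show ?thesis using f1 f5 xK by metis
  qed
  have supA: "{j. x j \<noteq> 0} \<subseteq> A \<union> B" if "m > 0"
  proof -
    have "A \<subseteq> {j. x j \<noteq> 0}" using m_le that by fastforce
    then show ?thesis by (rule f4[OF xK])
  qed
  obtain b0 where b0: "b0 \<in> B" "x b0 = 0"
  proof -
    show ?thesis using that nB by blast
  qed
  have b0A: "b0 \<notin> A" using AB b0 by blast
  have y0: "y j \<ge> 0" for j using x0[of j] m0 m_le[of j] by (simp add: yj)
  have miny: "Min (y ` B) = real (card A) / real (card B) * m"
  proof (rule Min_eqI)
    show "finite (y ` B)" using AB by simp
    show "real (card A) / real (card B) * m \<le> z" if "z \<in> y ` B" for z
      using that x0 AB by (auto simp: yj)
    show "real (card A) / real (card B) * m \<in> y ` B"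
      using b0 b0A by (intro image_eqI[of _ _ b0]) (auto simp: yj)
  qed
  have inv: "flip_map B A y = x"
  proof
    fix j
    have "real (card B) / real (card A) * (real (card A) / real (card B) * m) = m"
      using cA cB by simp
    then show "flip_map B A y j = x j"
      using AB(5) unfolding flip_map_def miny Let_def by (auto simp: yj)
  qed
  then show "flip_map B A (flip_map A B x) = x" by (simp add: y_def)
  have "y \<in> geom_realization K'"
  proof (cases "m = 0")
    case True
    then have "y = x" by (auto simp: fun_eq_iff yj)
    moreover have "{j. x j \<noteq> 0} \<in> K'"
    proof (cases "{j. x j \<noteq> 0} \<subseteq> A \<union> B")
      case True
      have "\<not> A \<subseteq> {j. x j \<noteq> 0}" using a0 \<open>m = 0\<close> by auto
      then show ?thesis using f3 True by simp
    qed (use f1 xK in simp)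
    ultimately show ?thesis using x0 xf xs by (simp add: geom_realization_def)
  next
    case False
    with m0 have mp: "m > 0" by simp
    have xz: "x j = 0" if "j \<notin> A \<union> B" for j using supA[OF mp] that by blast
    have ysub: "{j. y j \<noteq> 0} \<subseteq> A \<union> B" using xz by (auto simp: yj)
    have fAB: "finite (A \<union> B)" using AB by simp
    have "(\<Sum>j | y j \<noteq> 0. y j) = (\<Sum>j\<in>A \<union> B. y j)"
      using ysub fAB by (intro sum.mono_neutral_left) auto
    also have "\<dots> = (\<Sum>j\<in>A. y j) + (\<Sum>j\<in>B. y j)" using AB by (intro sum.union_disjoint) auto
    \<comment> \<open>The factor \<open>card A / card B\<close> is chosen for this balance:
      \<open>A\<close> loses \<open>card A * m\<close> in total and \<open>B\<close> gains the
      same.\<close>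
    also have "(\<Sum>j\<in>A. y j) = (\<Sum>j\<in>A. x j) - real (card A) * m"
      by (simp add: yj sum_subtractf)
    also have "(\<Sum>j\<in>B. y j) = (\<Sum>j\<in>B. x j + real (card A) / real (card B) * m)"
      using AB by (intro sum.cong) (auto simp: yj)
    also have "\<dots> = (\<Sum>j\<in>B. x j) + real (card A) * m"
      using cB by (simp add: sum.distrib)
    finally have "(\<Sum>j | y j \<noteq> 0. y j) = (\<Sum>j\<in>A. x j) + (\<Sum>j\<in>B. x j)" by simp
    also have "\<dots> = (\<Sum>j\<in>A \<union> B. x j)" using AB by (intro sum.union_disjoint[symmetric]) auto
    also have "\<dots> = (\<Sum>j | x j \<noteq> 0. x j)"
      using xz fAB by (intro sum.mono_neutral_right) auto
    finally have "(\<Sum>j | y j \<noteq> 0. y j) = 1" using xs by simp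
    moreover have "\<not> A \<subseteq> {j. y j \<noteq> 0}" using a0 by (auto simp: yj)
    then have "{j. y j \<noteq> 0} \<in> K'" using f3 ysub by simp
    moreover have "finite {j. y j \<noteq> 0}" using ysub fAB finite_subset by blast
    ultimately show ?thesis using y0 by (simp add: geom_realization_def)
  qed
  then show "flip_map A B x \<in> geom_realization K'" by (simp add: y_def)
qed

theorem flip_homeomorphic:
  assumes "flip A B K K'"
  shows "subtopology (powertop_real UNIV) (geom_realization K) homeomorphic_space
         subtopology (powertop_real UNIV) (geom_realization K')"
proof -
  have AB: "finite A" "finite B" "A \<noteq> {}" "B \<noteq> {}"
    using assms by (simp_all only: flip_def simp_thms)
  show ?thesis
    by (rule homeomorphic_space_powertopI[where f = "flip_map A B" and g = "flip_map B A"])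
      (simp_all add: AB continuous_on_flip_map image_subset_iff
        flip_map_realization[OF assms] flip_map_realization[OF flip_sym[OF assms]])
qed

section \<open>The boundary of a simplex as the standard sphere\<close>

text \<open>Both spaces parametrise the rays of (D+2)-space modulo the all-ones line. The simplex
  boundary picks the representative with minimum 0 and sum 1, the sphere the one with last
  coordinate 0 and norm 1; \<open>f\<close> and \<open>g\<close> change the representative.\<close>

lemma simplex_boundary_homeomorphic_nsphere:
  "subtopology (powertop_real UNIV) (geom_realization {G. G \<subset> {1..D + 2}}) homeomorphic_space nsphere D"
proof -
  define S where "S = geom_realization {G. G \<subset> {1..D + 2}}"
  define T where "T = {z :: nat \<Rightarrow> real. (\<Sum>i\<le>D. (z i)\<^sup>2) = 1 \<and> (\<forall>i>D. z i = 0)}"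
  define h where "h x i = (if i \<le> D then x (Suc i) - x (D + 2) else 0)" for x :: "nat \<Rightarrow> real" and i :: nat
  define nrm where "nrm x = sqrt (\<Sum>i\<le>D. (h x i)\<^sup>2)" for x
  define f where "f x i = h x i / nrm x" for x i
  define w where "w z i = (if i \<in> {1..D + 1} then z (i - 1) else 0)" for z :: "nat \<Rightarrow> real" and i :: nat
  define \<mu> where "\<mu> z = Min ((\<lambda>i. w z i) ` {1..D + 2})" for z
  define tot where "tot z = (\<Sum>i\<in>{1..D + 2}. w z i - \<mu> z)" for z
  define g where "g z i = (if i \<in> {1..D + 2} then (w z i - \<mu> z) / tot z else 0)" for z i
  have S_iff: "x \<in> S \<longleftrightarrow> (\<forall>j. 0 \<le> x j) \<and> (\<forall>j. j \<notin> {1..D + 2} \<longrightarrow> x j = 0) \<and>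
      (\<Sum>j\<in>{1..D + 2}. x j) = 1 \<and> (\<exists>j\<in>{1..D + 2}. x j = 0)" (is "_ \<longleftrightarrow> ?R") for x
  proof
    assume "x \<in> S"
    then have a: "\<And>j. 0 \<le> x j" "(\<Sum>j | x j \<noteq> 0. x j) = 1" "{j. x j \<noteq> 0} \<subset> {1..D + 2}"
      by (auto simp: S_def geom_realization_def)
    have "(\<Sum>j | x j \<noteq> 0. x j) = (\<Sum>j\<in>{1..D + 2}. x j)"
      using a(3) by (intro sum.mono_neutral_left) auto
    with a show ?R by auto
  next
    assume r: ?R
    then have sub: "{j. x j \<noteq> 0} \<subset> {1..D + 2}" by auto
    then have "(\<Sum>j | x j \<noteq> 0. x j) = (\<Sum>j\<in>{1..D + 2}. x j)"
      by (intro sum.mono_neutral_left) auto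
    with r sub show "x \<in> S"
      unfolding S_def geom_realization_def using finite_subset[OF psubset_imp_subset[OF sub]] by auto
  qed
  have hpos: "nrm x > 0" if "x \<in> S" for x
  proof -
    have "\<exists>i\<le>D. h x i \<noteq> 0"
    proof (rule ccontr)
      assume "\<not> ?thesis"
      then have e: "x (Suc i) = x (D + 2)" if "i \<le> D" for i using that by (auto simp: h_def)
      have eq: "x j = x (D + 2)" if "j \<in> {1..D + 2}" for j
        using that e[of "j - 1"] by (cases "j = D + 2") auto
      obtain j where "j \<in> {1..D + 2}" "x j = 0" using \<open>x \<in> S\<close> S_iff by blast
      then have "x (D + 2) = 0" using eq[of j] by simp
      then have "x j = 0" if "j \<in> {1..D + 2}" for j using eq[OF that] by simp
      then have "(\<Sum>j\<in>{1..D + 2}. x j) = 0" by (intro sum.neutral) blast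
      then show False using \<open>x \<in> S\<close> S_iff by simp
    qed
    then have "0 < (\<Sum>i\<le>D. (h x i)\<^sup>2)" by (auto intro!: sum_pos2)
    then show ?thesis by (simp add: nrm_def)
  qed
  have mu_le: "\<mu> z \<le> w z i" if "i \<in> {1..D + 2}" for z i
    unfolding \<mu>_def using that by (intro Min_le) auto
  have mu_ex: "\<exists>i\<in>{1..D + 2}. w z i = \<mu> z" for z
  proof -
    have "\<mu> z \<in> (\<lambda>i. w z i) ` {1..D + 2}" unfolding \<mu>_def by (intro Min_in) auto
    then show ?thesis by (auto simp: image_iff)
  qed
  have totpos: "tot z > 0" if z: "z \<in> T" for z
  proof -
    have "\<exists>i\<le>D. z i \<noteq> 0"
    proof (rule ccontr)
      assume "\<not> ?thesis"
      then have "(\<Sum>i\<le>D. (z i)\<^sup>2) = 0" by simp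
      then show False using z by (simp add: T_def)
    qed
    then obtain i where i: "i \<le> D" "z i \<noteq> 0" by blast
    have "\<exists>j\<in>{1..D + 2}. w z j \<noteq> \<mu> z"
    proof (cases "\<mu> z = 0")
      case True
      then show ?thesis using i by (intro bexI[of _ "Suc i"]) (auto simp: w_def)
    next
      case False
      then show ?thesis by (intro bexI[of _ "D + 2"]) (auto simp: w_def)
    qed
    then obtain j where j: "j \<in> {1..D + 2}" "w z j \<noteq> \<mu> z" by blast
    then have "w z j - \<mu> z > 0" using mu_le[of j z] by simp
    then show ?thesis unfolding tot_def using j mu_le by (intro sum_pos2[of _ j]) auto
  qed
  have fT: "f x \<in> T" if "x \<in> S" for x
  proof -
    have e: "(\<Sum>i\<le>D. (h x i)\<^sup>2) = (nrm x)\<^sup>2"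
      unfolding nrm_def by (simp add: sum_nonneg)
    have "(\<Sum>i\<le>D. (f x i)\<^sup>2) = (\<Sum>i\<le>D. (h x i)\<^sup>2) / (nrm x)\<^sup>2"
      by (simp add: f_def power_divide sum_divide_distrib)
    then have "(\<Sum>i\<le>D. (f x i)\<^sup>2) = 1" using hpos[OF that] e by simp
    then show ?thesis by (auto simp: T_def f_def h_def)
  qed
  have gS: "g z \<in> S" if "z \<in> T" for z
  proof -
    have t: "tot z > 0" by (rule totpos[OF that])
    have "(\<Sum>j\<in>{1..D + 2}. g z j) = (\<Sum>j\<in>{1..D + 2}. (w z j - \<mu> z) / tot z)"
      by (intro sum.cong) (auto simp: g_def)
    also have "\<dots> = 1" using t by (simp add: sum_divide_distrib[symmetric] tot_def)
    finally have "(\<Sum>j\<in>{1..D + 2}. g z j) = 1" .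
    moreover have "\<exists>j\<in>{1..D + 2}. g z j = 0" using mu_ex[of z] by (auto simp: g_def)
    moreover have "g z j \<ge> 0" for j using t mu_le[of j z] by (auto simp: g_def)
    ultimately show ?thesis unfolding S_iff by (auto simp: g_def)
  qed
  have gf: "g (f x) = x" if x: "x \<in> S" for x
  proof -
    have n: "nrm x > 0" by (rule hpos[OF x])
    have xS: "\<And>j. 0 \<le> x j" "\<And>j. j \<notin> {1..D + 2} \<Longrightarrow> x j = 0" "(\<Sum>j\<in>{1..D + 2}. x j) = 1"
      "\<exists>j\<in>{1..D + 2}. x j = 0" using x S_iff by blast+
    have wf: "w (f x) i = (x i - x (D + 2)) / nrm x" if "i \<in> {1..D + 2}" for i
    proof (cases "i = D + 2")
      case False
      then have "i \<in> {1..D + 1}" using that by auto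
      then show ?thesis by (auto simp: w_def f_def h_def)
    qed (simp add: w_def)
    obtain j where j: "j \<in> {1..D + 2}" "x j = 0" using xS(4) by blast
    have mu: "\<mu> (f x) = - x (D + 2) / nrm x"
      unfolding \<mu>_def
    proof (rule Min_eqI)
      show "- x (D + 2) / nrm x \<le> y" if "y \<in> (\<lambda>i. w (f x) i) ` {1..D + 2}" for y
        using that wf n xS(1) by (auto simp: diff_divide_distrib)
      show "- x (D + 2) / nrm x \<in> (\<lambda>i. w (f x) i) ` {1..D + 2}"
        using j wf[OF j(1)] by (intro image_eqI[of _ _ j]) auto
    qed simp
    have d: "w (f x) i - \<mu> (f x) = x i / nrm x" if "i \<in> {1..D + 2}" for i
      using wf[OF that] mu n by (simp add: field_simps)
    have "tot (f x) = (\<Sum>i\<in>{1..D + 2}. x i / nrm x)"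
      unfolding tot_def by (intro sum.cong) (auto simp: d)
    also have "\<dots> = 1 / nrm x" using xS(3) by (simp only: sum_divide_distrib[symmetric])
    finally have t: "tot (f x) = 1 / nrm x" .
    show ?thesis
    proof
      fix i show "g (f x) i = x i"
        using d[of i] n xS(2)[of i] by (auto simp: g_def t)
    qed
  qed
  have fg: "f (g z) = z" if z: "z \<in> T" for z
  proof -
    have t: "tot z > 0" by (rule totpos[OF z])
    have hg: "h (g z) i = z i / tot z" for i
    proof (cases "i \<le> D")
      case True
      then have "h (g z) i = (w z (Suc i) - \<mu> z) / tot z - (w z (D + 2) - \<mu> z) / tot z"
        by (simp add: h_def g_def)
      also have "\<dots> = (w z (Suc i) - w z (D + 2)) / tot z" by (simp add: diff_divide_distrib)
      also have "\<dots> = z i / tot z" using True by (simp add: w_def)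
      finally show ?thesis .
    qed (use z in \<open>simp add: h_def T_def\<close>)
    have "(\<Sum>i\<le>D. (h (g z) i)\<^sup>2) = (\<Sum>i\<le>D. (z i)\<^sup>2) / (tot z)\<^sup>2"
      by (simp add: hg power_divide sum_divide_distrib)
    then have "nrm (g z) = 1 / tot z"
      using z t by (simp add: nrm_def T_def real_sqrt_divide)
    then show ?thesis using t by (auto simp: f_def hg fun_eq_iff)
  qed
  have ch: "continuous_on X (\<lambda>x. h x i)" for i and X
    by (cases "i \<le> D") (auto simp: h_def intro!: continuous_intros continuous_on_coordinate)
  have "continuous_on S (\<lambda>x. f x i)" for i
    unfolding f_def nrm_def
    using hpos by (intro continuous_intros ch) (force simp: nrm_def)
  then have cf: "continuous_on S f" by (rule continuous_on_coordinatewise_then_product)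
  have cw: "continuous_on X (\<lambda>x. w x i)" for i and X
    by (cases "i \<in> {1..D + 1}") (auto simp: w_def intro!: continuous_intros continuous_on_coordinate)
  have cmu: "continuous_on X \<mu>" for X
    unfolding \<mu>_def by (intro continuous_on_Min_image cw) auto
  have ct: "continuous_on X tot" for X
    unfolding tot_def by (intro continuous_intros cw cmu)
  have "continuous_on T (\<lambda>x. g x i)" for i
  proof (cases "i \<in> {1..D + 2}")
    case True
    have "tot z \<noteq> 0" if "z \<in> T" for z using totpos[OF that] by simp
    then show ?thesis using True unfolding g_def
      by (auto intro!: continuous_intros cw cmu ct)
  qed (auto simp: g_def)
  then have cg: "continuous_on T g" by (rule continuous_on_coordinatewise_then_product)
  have "subtopology (powertop_real UNIV) S homeomorphic_space subtopology (powertop_real UNIV) T"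
    by (rule homeomorphic_space_powertopI[OF cf cg]) (use fT gS gf fg in auto)
  then show ?thesis by (simp add: S_def T_def nsphere)
qed

lemma geom_realization_relabel:
  assumes e: "bij_betw e V V'" and K: "\<And>G. G \<in> K \<Longrightarrow> G \<subseteq> V"
  shows "subtopology (powertop_real UNIV) (geom_realization K) homeomorphic_space
         subtopology (powertop_real UNIV) (geom_realization ((`) e ` K))"
proof -
  define g where "g = the_inv_into V e"
  have ge: "g (e x) = x" if "x \<in> V" for x
    using e that by (simp add: g_def bij_betw_def the_inv_into_f_f)
  have eg: "e (g y) = y" and gV: "g y \<in> V" if "y \<in> V'" for y
    using e that by (auto simp: g_def bij_betw_def f_the_inv_into_f the_inv_into_into)
  have eV: "e x \<in> V'" if "x \<in> V" for x using e that by (auto simp: bij_betw_def)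
  define p where "p x j = (if j \<in> V' then x (g j) else 0)" for x :: "nat \<Rightarrow> real" and j
  define q where "q x j = (if j \<in> V then x (e j) else 0)" for x :: "nat \<Rightarrow> real" and j
  have inje: "inj_on e S" if "S \<subseteq> V" for S using e that by (meson bij_betw_def inj_on_subset)
  have supp: "{j. p x j \<noteq> 0} = e ` {j. x j \<noteq> 0}" if "{j. x j \<noteq> 0} \<subseteq> V" for x
  proof (intro set_eqI iffI)
    fix j assume "j \<in> {j. p x j \<noteq> 0}"
    then have "j \<in> V'" "x (g j) \<noteq> 0" by (auto simp: p_def split: if_splits)
    then show "j \<in> e ` {j. x j \<noteq> 0}" by (intro image_eqI[of _ _ "g j"]) (simp_all add: eg)
  next
    fix j assume "j \<in> e ` {j. x j \<noteq> 0}"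
    then obtain i where "j = e i" "x i \<noteq> 0" by auto
    moreover from this that have "i \<in> V" by auto
    ultimately show "j \<in> {j. p x j \<noteq> 0}" by (simp add: p_def ge eV)
  qed
  have pin: "p x \<in> geom_realization ((`) e ` K)" and qp: "q (p x) = x"
    if x: "x \<in> geom_realization K" for x
  proof -
    have s: "{j. x j \<noteq> 0} \<in> K" "finite {j. x j \<noteq> 0}" "(\<Sum>j | x j \<noteq> 0. x j) = 1" "\<And>j. 0 \<le> x j"
      using x by (auto simp: geom_realization_def)
    note sV = K[OF s(1)]
    have "(\<Sum>j | p x j \<noteq> 0. p x j) = (\<Sum>j | x j \<noteq> 0. p x (e j))"
      unfolding supp[OF sV] by (subst sum.reindex) (use inje sV in auto)
    also have "\<dots> = (\<Sum>j | x j \<noteq> 0. x j)"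
      using sV ge eV by (intro sum.cong) (auto simp: p_def)
    finally have "(\<Sum>j | p x j \<noteq> 0. p x j) = 1" using s(3) by simp
    then show "p x \<in> geom_realization ((`) e ` K)"
      using s supp[OF sV] by (simp add: geom_realization_def p_def)
    show "q (p x) = x"
      using sV ge eV by (auto simp: q_def p_def fun_eq_iff)
  qed
  have qin: "q y \<in> geom_realization K" and pq: "p (q y) = y"
    if y: "y \<in> geom_realization ((`) e ` K)" for y
  proof -
    have s: "{j. y j \<noteq> 0} \<in> (`) e ` K" "finite {j. y j \<noteq> 0}" "(\<Sum>j | y j \<noteq> 0. y j) = 1" "\<And>j. 0 \<le> y j"
      using y by (auto simp: geom_realization_def)
    then obtain G where G: "G \<in> K" "{j. y j \<noteq> 0} = e ` G" by blast
    have GV: "G \<subseteq> V" by (rule K[OF G(1)])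
    have sV: "{j. y j \<noteq> 0} \<subseteq> V'" using G GV eV by auto
    have sq: "{j. q y j \<noteq> 0} = G"
    proof (intro set_eqI iffI)
      fix j assume "j \<in> {j. q y j \<noteq> 0}"
      then have "j \<in> V" "y (e j) \<noteq> 0" by (auto simp: q_def split: if_splits)
      then have "e j \<in> e ` G" using G by blast
      then show "j \<in> G" using GV \<open>j \<in> V\<close> e by (metis bij_betw_def inj_on_image_mem_iff)
    next
      fix j assume "j \<in> G"
      then have "y (e j) \<noteq> 0" "j \<in> V" using G GV by blast+
      then show "j \<in> {j. q y j \<noteq> 0}" by (simp add: q_def)
    qed
    have "(\<Sum>j\<in>G. q y j) = (\<Sum>j\<in>G. y (e j))"
      using GV by (intro sum.cong) (auto simp: q_def)
    also have "\<dots> = (\<Sum>j | y j \<noteq> 0. y j)"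
      unfolding G(2) by (subst sum.reindex) (use inje GV in auto)
    finally have "(\<Sum>j\<in>G. q y j) = 1" using s(3) by simp
    moreover have "finite G" using s(2) G(2) inje[OF GV] by (simp add: finite_image_iff)
    ultimately show "q y \<in> geom_realization K"
      using s(4) G(1) by (simp add: geom_realization_def sq) (simp add: q_def)
    show "p (q y) = y"
      using sV eg gV by (auto simp: q_def p_def fun_eq_iff)
  qed
  have "continuous_on X (\<lambda>x. p x j)" "continuous_on X (\<lambda>x. q x j)" for X j
    by (cases "j \<in> V'"; cases "j \<in> V"; simp add: p_def q_def continuous_on_coordinate)+
  then have "continuous_on X p" "continuous_on X q" for X
    by (auto intro: continuous_on_coordinatewise_then_product)
  then show ?thesis
    by (intro homeomorphic_space_powertopI[of _ p _ q]) (auto simp: pin qin pq qp)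
qed

lemma proper_subsets_homeomorphic_nsphere:
  assumes "finite F" "card F = D + 2"
  shows "subtopology (powertop_real UNIV) (geom_realization {G. G \<subset> F}) homeomorphic_space nsphere D"
proof -
  obtain e where e: "bij_betw e {1..D + 2} F"
    using assms by (metis add_diff_cancel_right' card_atLeastAtMost finite_atLeastAtMost finite_same_card_bij Suc_eq_plus1)
  have "(`) e ` {G. G \<subset> {1..D + 2}} = {G. G \<subset> F}"
  proof (intro set_eqI iffI)
    fix G assume "G \<in> (`) e ` {G. G \<subset> {1..D + 2}}"
    then obtain G' where "G = e ` G'" "G' \<subset> {1..D + 2}" by blast
    then show "G \<in> {G. G \<subset> F}"
      using e by (metis bij_betw_def image_strict_mono mem_Collect_eq)
  next
    fix G assume "G \<in> {G. G \<subset> F}"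
    then have G: "G \<subset> F" by simp
    define G' where "G' = {x \<in> {1..D + 2}. e x \<in> G}"
    have "e ` G' = G" using e G by (auto simp: G'_def bij_betw_def)
    moreover have "G' \<noteq> {1..D + 2}" using calculation e G by (metis bij_betw_def psubset_eq)
    then have "G' \<subset> {1..D + 2}" by (auto simp: G'_def)
    ultimately show "G \<in> (`) e ` {G. G \<subset> {1..D + 2}}" by blast
  qed
  then have "subtopology (powertop_real UNIV) (geom_realization {G. G \<subset> {1..D + 2}}) homeomorphic_space
      subtopology (powertop_real UNIV) (geom_realization {G. G \<subset> F})"
    using geom_realization_relabel[OF e, of "{G. G \<subset> {1..D + 2}}"] by auto
  then show ?thesis
    using simplex_boundary_homeomorphic_nsphere homeomorphic_space_sym homeomorphic_space_trans by blast
qed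

section \<open>Moving a cell across a hypersurface\<close>

definition down :: "nat set set \<Rightarrow> nat set set" where
  "down X = {G. \<exists>F\<in>X. G \<subseteq> F}"

text \<open>When \<open>L\<close> and \<open>U\<close> partition the facets of a sphere, this is the
  hypersurface separating the two regions.\<close>

definition bd :: "nat set set \<Rightarrow> nat set set \<Rightarrow> nat set set" where
  "bd L U = down L \<inter> down U"

text \<open>\<open>X\<close> and \<open>Y\<close> are the cells of two complementary regions of a sphere; the region \<open>X\<close> is replaced
  by the cone over its boundary with apex \<open>v\<close>.\<close>

definition cone :: "nat \<Rightarrow> nat set set \<Rightarrow> nat set set \<Rightarrow> nat set set" where
  "cone v X Y = {H. if v \<in> H then H - {v} \<in> bd X Y else H \<in> down Y}"

lemma down_insert: "G \<in> down (insert F X) \<longleftrightarrow> G \<subseteq> F \<or> G \<in> down X"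
  by (auto simp: down_def)

lemma downI: "G \<subseteq> F \<Longrightarrow> F \<in> X \<Longrightarrow> G \<in> down X"
  by (auto simp: down_def)

lemma down_mono: "G \<in> down X \<Longrightarrow> H \<subseteq> G \<Longrightarrow> H \<in> down X"
  by (auto simp: down_def)

text \<open>The cell \<open>A \<union> R\<close> can pass from the region \<open>U\<close> to the region \<open>L\<close>: it meets \<open>L\<close> in the ridges
  opposite to \<open>R\<close> and the rest of \<open>U\<close> in the ridges opposite to \<open>A\<close>.\<close>

definition cell_move :: "nat set \<Rightarrow> nat set \<Rightarrow> nat set set \<Rightarrow> nat set set \<Rightarrow> bool" where
  "cell_move A R L U \<longleftrightarrow> finite A \<and> finite R \<and> A \<inter> R = {} \<and> A \<noteq> {} \<and> R \<noteq> {} \<and>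
     R \<notin> down L \<and> (\<forall>u\<in>R. A \<union> R - {u} \<in> down L) \<and>
     A \<notin> down U \<and> (\<forall>u\<in>A. A \<union> R - {u} \<in> down U)"

lemma cell_move_sym: "cell_move A R L U \<Longrightarrow> cell_move R A U L"
  unfolding cell_move_def Un_commute[of R A] Int_commute[of R A] by (elim conjE, intro conjI)

text \<open>A subset of the cell that misses some \<open>u\<close> lies in the ridge opposite to
  \<open>u\<close>, so the incidences of the ridges and of \<open>R\<close> and \<open>A\<close>
  decide those of all subsets.\<close>

lemma cell_move_down:
  assumes "cell_move A R L U" "H \<subseteq> A \<union> R"
  shows "H \<in> down L \<longleftrightarrow> \<not> R \<subseteq> H" "H \<in> down U \<longleftrightarrow> \<not> A \<subseteq> H"
proof -
  have "R \<notin> down L" "\<And>u. u \<in> R \<Longrightarrow> A \<union> R - {u} \<in> down L"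
    and "A \<notin> down U" "\<And>u. u \<in> A \<Longrightarrow> A \<union> R - {u} \<in> down U"
    using assms(1) by (auto simp: cell_move_def)
  moreover have "H \<subseteq> A \<union> R - {u}" if "u \<notin> H" for u using that assms(2) by blast
  ultimately show "H \<in> down L \<longleftrightarrow> \<not> R \<subseteq> H" "H \<in> down U \<longleftrightarrow> \<not> A \<subseteq> H"
    using down_mono by (metis subsetI)+
qed

lemma flipI:
  assumes "finite A" "finite B" "A \<noteq> {}" "B \<noteq> {}" "A \<inter> B = {}"
    and "\<And>H. \<not> H \<subseteq> A \<union> B \<Longrightarrow> H \<in> K \<longleftrightarrow> H \<in> K'"
    and "\<And>H. H \<subseteq> A \<union> B \<Longrightarrow> H \<in> K \<longleftrightarrow> \<not> B \<subseteq> H"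
    and "\<And>H. H \<subseteq> A \<union> B \<Longrightarrow> H \<in> K' \<longleftrightarrow> \<not> A \<subseteq> H"
    and "\<And>H. H \<in> K \<Longrightarrow> A \<subseteq> H \<Longrightarrow> H \<subseteq> A \<union> B"
    and "\<And>H. H \<in> K' \<Longrightarrow> B \<subseteq> H \<Longrightarrow> H \<subseteq> A \<union> B"
  shows "flip A B K K'"
  unfolding flip_def using assms(1-5) assms(6-) by (intro conjI allI ballI impI)

text \<open>The boundary of the cell consists of \<open>A\<close> joined with \<partial>R, facing
  \<open>L\<close>, and \<partial>A joined with \<open>R\<close>, facing the rest of
  \<open>U\<close>. Pushing the hypersurface across the cell exchanges the two.\<close>

lemma flip_bd:
  assumes m: "cell_move A R L U"
  shows "flip A R (bd L (insert (A \<union> R) U)) (bd (insert (A \<union> R) L) U)"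
proof (rule flipI)
  show "finite A" "finite R" "A \<noteq> {}" "R \<noteq> {}" "A \<inter> R = {}" using m by (auto simp: cell_move_def)
  have no: "R \<notin> down L" "A \<notin> down U" using m by (auto simp: cell_move_def)
  fix H
  show "H \<in> bd L (insert (A \<union> R) U) \<longleftrightarrow> H \<in> bd (insert (A \<union> R) L) U" if "\<not> H \<subseteq> A \<union> R"
    using that by (simp add: bd_def down_insert)
  show "H \<in> bd L (insert (A \<union> R) U) \<longleftrightarrow> \<not> R \<subseteq> H" "H \<in> bd (insert (A \<union> R) L) U \<longleftrightarrow> \<not> A \<subseteq> H"
    if "H \<subseteq> A \<union> R"
    using that cell_move_down[OF m that] by (auto simp: bd_def down_insert)
  show "H \<subseteq> A \<union> R" if "H \<in> bd L (insert (A \<union> R) U)" "A \<subseteq> H"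
    using that no down_mono by (auto simp: bd_def down_insert)
  show "H \<subseteq> A \<union> R" if "H \<in> bd (insert (A \<union> R) L) U" "R \<subseteq> H"
    using that no down_mono by (auto simp: bd_def down_insert)
qed

text \<open>The same move, seen one dimension higher: the cell \<open>A \<union> R\<close> and the
  cone over \<open>A\<close> joined with \<partial>R together form \<open>A\<close> joined with the
  boundary of \<open>insert v R\<close>. After the move, the cone over \<partial>A joined with
  \<open>R\<close> takes their place.\<close>

lemma flip_cone:
  assumes m: "cell_move A R L U" and v: "v \<notin> A \<union> R"
  shows "flip A (insert v R) (cone v L (insert (A \<union> R) U)) (cone v (insert (A \<union> R) L) U)"
proof (rule flipI)
  show "finite A" "finite (insert v R)" "A \<noteq> {}" "insert v R \<noteq> {}" "A \<inter> insert v R = {}"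
    using m v by (auto simp: cell_move_def)
  have no: "R \<notin> down L" "A \<notin> down U" using m by (auto simp: cell_move_def)
  fix H
  have e: "H \<subseteq> A \<union> insert v R \<longleftrightarrow> H - {v} \<subseteq> A \<union> R" "A \<subseteq> H \<longleftrightarrow> A \<subseteq> H - {v}"
    "insert v R \<subseteq> H \<longleftrightarrow> v \<in> H \<and> R \<subseteq> H - {v}"
    using v by auto
  have d: "H - {v} = H" if "v \<notin> H" using that by simp
  let ?K = "cone v L (insert (A \<union> R) U)" and ?K' = "cone v (insert (A \<union> R) L) U"
  show "H \<in> ?K \<longleftrightarrow> H \<in> ?K'" if "\<not> H \<subseteq> A \<union> insert v R"
    using that unfolding e cone_def by (auto simp: bd_def down_insert)
  show "H \<in> ?K \<longleftrightarrow> \<not> insert v R \<subseteq> H" if "H \<subseteq> A \<union> insert v R"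
    using that cell_move_down[OF m, of "H - {v}"] d unfolding e cone_def
    by (cases "v \<in> H") (auto simp: bd_def down_insert)
  show "H \<in> ?K' \<longleftrightarrow> \<not> A \<subseteq> H" if "H \<subseteq> A \<union> insert v R"
    using that cell_move_down[OF m, of "H - {v}"] d unfolding e cone_def
    by (cases "v \<in> H") (auto simp: bd_def down_insert)
  show "H \<subseteq> A \<union> insert v R" if "H \<in> ?K" "A \<subseteq> H"
    using that no down_mono[of "H - {v}" U A] d unfolding e cone_def
    by (cases "v \<in> H") (auto simp: bd_def down_insert)
  show "H \<subseteq> A \<union> insert v R" if "H \<in> ?K'" "insert v R \<subseteq> H"
    using that no down_mono[of "H - {v}" L R] unfolding e cone_def
    by (auto simp: bd_def down_insert)
qed

text \<open>Both parities of \<open>d\<close> need the same cell moves, so the two conclusions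
  travel through one induction: the hypersurface serves odd \<open>d\<close>, the sphere with
  \<open>U\<close> coned off serves even \<open>d\<close>.\<close>

definition spheres :: "nat \<Rightarrow> nat \<Rightarrow> nat set set \<Rightarrow> nat set set \<Rightarrow> bool" where
  "spheres D v L U \<longleftrightarrow>
     subtopology (powertop_real UNIV) (geom_realization (bd L U)) homeomorphic_space nsphere D \<and>
     subtopology (powertop_real UNIV) (geom_realization (cone v U L)) homeomorphic_space nsphere (D + 1)"

lemma spheres_move:
  assumes m: "cell_move A R L U" and v: "v \<notin> A \<union> R" and s: "spheres D v L (insert (A \<union> R) U)"
  shows "spheres D v (insert (A \<union> R) L) U"
proof -
  \<comment> \<open>Here the coned region is \<open>U\<close>, which loses the cell; hence the
    reversed move is used and the resulting flip is inverted.\<close>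
  have "flip (insert v A) R (cone v (insert (A \<union> R) U) L) (cone v U (insert (A \<union> R) L))"
    using flip_cone[OF cell_move_sym[OF m], THEN flip_sym] v by (simp add: Un_commute)
  from flip_homeomorphic[OF this] flip_homeomorphic[OF flip_bd[OF m]] s show ?thesis
    unfolding spheres_def using homeomorphic_space_sym homeomorphic_space_trans by blast
qed

text \<open>Start of the induction: the hypersurface is \<partial>F, and coning off the other side
  completes \<open>F\<close> to the boundary of the simplex \<open>insert v F\<close>.\<close>

lemma spheres_simplex:
  assumes F: "finite F" "card F = D + 2" "v \<notin> F" "F \<notin> down U" "\<And>u. u \<in> F \<Longrightarrow> F - {u} \<in> down U"
  shows "spheres D v {F} U"
proof -
  have sub: "H \<in> down U \<longleftrightarrow> H \<noteq> F" if HF: "H \<subseteq> F" for H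
  proof
    assume "H \<noteq> F"
    then obtain u where "u \<in> F" "H \<subseteq> F - {u}" using HF by blast
    then show "H \<in> down U" using F(5) down_mono by blast
  qed (use F(4) in blast)
  have dF: "down {F} = {H. H \<subseteq> F}" by (auto simp: down_def)
  have "bd {F} U = {G. G \<subset> F}"
    using sub by (auto simp: bd_def dF psubset_eq)
  moreover have "cone v U {F} = {G. G \<subset> insert v F}"
  proof (intro set_eqI)
    fix H
    show "H \<in> cone v U {F} \<longleftrightarrow> H \<in> {G. G \<subset> insert v F}"
    proof (cases "v \<in> H")
      case True
      have "H \<subseteq> insert v F \<longleftrightarrow> H - {v} \<subseteq> F" "H = insert v F \<longleftrightarrow> H - {v} = F"
        using True F(3) by auto
      then show ?thesis using True sub[of "H - {v}"] by (auto simp: cone_def bd_def dF psubset_eq)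
    next
      case False
      then show ?thesis by (auto simp: cone_def dF)
    qed
  qed
  ultimately show ?thesis
    unfolding spheres_def
    using proper_subsets_homeomorphic_nsphere[of F D]
      proper_subsets_homeomorphic_nsphere[of "insert v F" "D + 1"] F by simp
qed

lemma sn_ge_card:
  assumes inj: "inj_on f X"
    and f: "\<And>A. A \<in> X \<Longrightarrow> simplicial_sphere d {1..n} (f A) \<and> neighborly (d div 2) {1..n} (f A)"
  shows "card X \<le> sn d n"
proof -
  let ?S = "{K. simplicial_sphere d {1..n} K \<and> neighborly (d div 2) {1..n} K}"
  \<comment> \<open>Finiteness has to be secured, since \<open>card\<close> of an infinite set would
    be 0.\<close>
  have "?S \<subseteq> Pow (Pow {1..n})"
    by (auto simp: simplicial_sphere_def simplicial_complex_on_def)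
  then have fin: "finite ?S" by (rule finite_subset) simp
  have "card X = card (f ` X)" using inj by (simp add: card_image)
  also have "\<dots> \<le> card ?S" using f by (intro card_mono[OF fin]) auto
  finally show ?thesis by (simp add: sn_def)
qed

section \<open>Cells of the cyclic sphere\<close>

text \<open>Only parities of this count matter: at a gap they express Gale's condition, at an
  element of a cell in \<open>P\<close> they tell the smaller from the larger member of a
  pair.\<close>

definition cnt :: "nat set \<Rightarrow> nat \<Rightarrow> nat" where
  "cnt F t = card (F \<inter> {..<t})"

lemma cnt_Suc: "finite F \<Longrightarrow> cnt F (Suc t) = cnt F t + (if t \<in> F then 1 else 0)"
proof -
  assume "finite F"
  have "F \<inter> {..<Suc t} = (if t \<in> F then insert t (F \<inter> {..<t}) else F \<inter> {..<t})"
    by (auto simp: less_Suc_eq)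
  with \<open>finite F\<close> show ?thesis by (simp add: cnt_def)
qed

lemma cnt_all: "F \<subseteq> {1..N} \<Longrightarrow> cnt F (Suc N) = card F"
proof -
  assume "F \<subseteq> {1..N}"
  then have "F \<inter> {..<Suc N} = F" by auto
  then show ?thesis by (simp add: cnt_def)
qed

lemma cnt_one: "F \<subseteq> {1..N} \<Longrightarrow> cnt F 1 = 0"
proof -
  assume "F \<subseteq> {1..N}"
  then have "F \<inter> {..<1} = {}" by auto
  then show ?thesis unfolding cnt_def by (metis card.empty)
qed

lemma cnt_initial: "F \<subseteq> {1..N} \<Longrightarrow> {1..r} \<subseteq> F \<Longrightarrow> t \<le> Suc r \<Longrightarrow> cnt F t = t - 1"
proof -
  assume "F \<subseteq> {1..N}" "{1..r} \<subseteq> F" "t \<le> Suc r"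
  then have "F \<inter> {..<t} = {1..<t}" by auto
  then show ?thesis by (simp add: cnt_def)
qed

lemma cnt_insert:
  assumes "finite F" "a \<notin> F"
  shows "cnt (insert a F) t = cnt F t + (if a < t then 1 else 0)"
proof -
  have "insert a F \<inter> {..<t} = (if a < t then insert a (F \<inter> {..<t}) else F \<inter> {..<t})" by auto
  then show ?thesis using assms by (simp add: cnt_def)
qed

text \<open>Stated additively to avoid truncated subtraction. The parity changes exactly at those
  \<open>t\<close> for which one of \<open>u < t\<close> and \<open>g < t\<close> holds and the
  other fails.\<close>

lemma cnt_swap:
  assumes "finite F" "u \<in> F" "g \<notin> F"
  shows "cnt (insert g (F - {u})) t + (if u < t then 1 else 0) = cnt F t + (if g < t then 1 else 0)"
proof -
  let ?X = "(F - {u}) \<inter> {..<t}"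
  have "F \<inter> {..<t} = (if u < t then insert u ?X else ?X)" using assms by auto
  then have 1: "cnt F t = card ?X + (if u < t then 1 else 0)"
    using assms by (simp add: cnt_def)
  have "insert g (F - {u}) \<inter> {..<t} = (if g < t then insert g ?X else ?X)" by auto
  then have "cnt (insert g (F - {u})) t = card ?X + (if g < t then 1 else 0)"
    using assms by (simp add: cnt_def)
  with 1 show ?thesis by simp
qed

lemma sum_swap:
  fixes F :: "nat set"
  assumes "finite F" "u \<in> F" "g \<notin> F"
  shows "\<Sum>(insert g (F - {u})) + u = \<Sum>F + g"
  using assms by (simp add: sum.remove)

lemma card_swap:
  assumes "finite F" "u \<in> F" "g \<notin> F"
  shows "card (insert g (F - {u})) = card F"
  using assms card_Suc_Diff1[of F u] by simp

text \<open>The maximum is at least the cardinality; removing it gives the induction. The equality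
  case provides the rigidity in \<open>upper_part_subset\<close>.\<close>

lemma sum_ge_initial:
  fixes X :: "nat set"
  assumes "finite X" "0 \<notin> X" "card X = r"
  shows "\<Sum>{1..r} \<le> \<Sum>X \<and> (\<Sum>X = \<Sum>{1..r} \<longrightarrow> X = {1..r})"
  using assms
proof (induction r arbitrary: X)
  case (Suc r)
  define m where "m = Max X"
  have ne: "X \<noteq> {}" using Suc.prems by auto
  have m: "m \<in> X" "\<And>x. x \<in> X \<Longrightarrow> x \<le> m" using Suc.prems ne by (auto simp: m_def)
  have "X \<subseteq> {1..m}"
  proof
    fix x assume "x \<in> X"
    then show "x \<in> {1..m}" using m(2)[of x] Suc.prems(2) by (cases x) auto
  qed
  then have "Suc r \<le> m" using card_mono[of "{1..m}" X] Suc.prems by simp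
  have IH: "\<Sum>{1..r} \<le> \<Sum>(X - {m})" "\<Sum>(X - {m}) = \<Sum>{1..r} \<longrightarrow> X - {m} = {1..r}"
    using Suc.IH[of "X - {m}"] Suc.prems m(1) by auto
  have s: "\<Sum>X = m + \<Sum>(X - {m})" using m(1) Suc.prems(1) by (simp add: sum.remove)
  have t: "\<Sum>{1..Suc r} = Suc r + \<Sum>{1..r}" by simp
  show ?case
  proof (intro conjI impI)
    show "\<Sum>{1..Suc r} \<le> \<Sum>X" using IH s t \<open>Suc r \<le> m\<close> by linarith
    assume "\<Sum>X = \<Sum>{1..Suc r}"
    then have "m = Suc r" "\<Sum>(X - {m}) = \<Sum>{1..r}" using IH s t \<open>Suc r \<le> m\<close> by linarith+
    then have "X = insert (Suc r) {1..r}" using IH(2) m(1) by auto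
    then show "X = {1..Suc r}" by auto
  qed
qed simp

definition lo :: "nat set \<Rightarrow> nat set" where "lo F = {x \<in> F. even (cnt F x)}"
definition hi :: "nat set \<Rightarrow> nat set" where "hi F = {x \<in> F. odd (cnt F x)}"
definition ini :: "nat set \<Rightarrow> nat set" where "ini F = {x \<in> F. {1..x} \<subseteq> F}"
text \<open>No gap lies below the initial run, so its elements cannot be exchanged for smaller ones;
  they are all assigned to the lower part. In the flips \<open>upper_part F\<close> is the set
  \<open>R\<close> and \<open>lower_part F\<close> the set \<open>A\<close>.\<close>

definition upper_part :: "nat set \<Rightarrow> nat set" where "upper_part F = hi F - ini F"
definition lower_part :: "nat set \<Rightarrow> nat set" where "lower_part F = lo F \<union> ini F"

text \<open>By Gale's evenness condition the facets of the cyclic polytope of dimension \<open>2k + 2\<close> with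
  vertices \<open>1, \<dots>, N\<close> are the sets in \<open>P \<union> W\<close> below: \<open>P\<close> consists of the disjoint unions of \<open>k + 1\<close>
  pairs \<open>{i, i + 1}\<close>, and in \<open>W\<close> one of the pairs is \<open>{N, 1}\<close>. The sets \<open>lo F\<close> and \<open>hi F\<close> collect the
  smaller and the larger elements of the pairs of \<open>F \<in> P\<close>.\<close>

locale cyclic_cells =
  fixes N k :: nat
  assumes Nk: "2 * k + 4 \<le> N"
begin

definition P :: "nat set set" where
  "P = {F. F \<subseteq> {1..N} \<and> card F = 2 * k + 2 \<and> (\<forall>t\<in>{1..N} - F. even (cnt F t))}"

definition W :: "nat set set" where
  "W = {F. F \<subseteq> {1..N} \<and> card F = 2 * k + 2 \<and> (\<forall>t\<in>{1..N} - F. odd (cnt F t))}"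

lemma P_D:
  assumes "F \<in> P"
  shows "F \<subseteq> {1..N}" "finite F" "card F = 2 * k + 2" "0 \<notin> F"
    "t \<in> {1..N} \<Longrightarrow> t \<notin> F \<Longrightarrow> even (cnt F t)"
  using assms finite_subset[of F "{1..N}"] by (auto simp: P_def)

lemma W_D:
  assumes "F \<in> W"
  shows "F \<subseteq> {1..N}" "finite F" "card F = 2 * k + 2" "0 \<notin> F"
    "t \<in> {1..N} \<Longrightarrow> t \<notin> F \<Longrightarrow> odd (cnt F t)"
  using assms finite_subset[of F "{1..N}"] by (auto simp: W_def)

lemma finite_P: "finite P"
  by (rule finite_subset[of _ "Pow {1..N}"]) (auto simp: P_def)

text \<open>Gale's condition excludes a gap at an odd count, and the even cardinality of
  \<open>F\<close> excludes \<open>x = N\<close>.\<close>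

lemma P_lo:
  assumes F: "F \<in> P" and x: "x \<in> F" "even (cnt F x)"
  shows "Suc x \<in> F" "odd (cnt F (Suc x))"
proof -
  show o: "odd (cnt F (Suc x))" using x cnt_Suc[OF P_D(2)[OF F]] by simp
  have "x \<in> {1..N}" using P_D(1)[OF F] x by blast
  moreover have "x \<noteq> N"
  proof
    assume "x = N"
    then have "card F = cnt F N + 1"
      using cnt_Suc[OF P_D(2)[OF F], of N] cnt_all[OF P_D(1)[OF F]] x by simp
    moreover have "even (card F)" using P_D(3)[OF F] by simp
    ultimately show False using x \<open>x = N\<close> by simp
  qed
  ultimately have "Suc x \<in> {1..N}" by auto
  then show "Suc x \<in> F" using P_D(5)[OF F, of "Suc x"] o by blast
qed

lemma P_hi:
  assumes F: "F \<in> P" and x: "x \<in> F" "odd (cnt F x)"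
  obtains y where "x = Suc y" "y \<in> F" "even (cnt F y)"
proof -
  have "x \<in> {1..N}" using P_D(1)[OF F] x by blast
  moreover have "x \<noteq> 1" using cnt_one[OF P_D(1)[OF F]] x(2) by (metis even_zero)
  ultimately obtain y where y: "x = Suc y" "y \<in> {1..N}" by (cases x) auto
  have "y \<in> F"
  proof (rule ccontr)
    assume "y \<notin> F"
    then have "even (cnt F y)" "cnt F x = cnt F y"
      using P_D(5)[OF F y(2)] cnt_Suc[OF P_D(2)[OF F], of y] y(1) by auto
    with x show False by simp
  qed
  moreover have "even (cnt F y)" using cnt_Suc[OF P_D(2)[OF F], of y] y(1) x(2) \<open>y \<in> F\<close> by simp
  ultimately show ?thesis using that y by blast
qed

lemma hi_eq: "F \<in> P \<Longrightarrow> hi F = Suc ` lo F"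
proof (intro set_eqI iffI)
  fix x assume F: "F \<in> P"
  { assume "x \<in> hi F"
    then have "x \<in> F" "odd (cnt F x)" by (auto simp: hi_def)
    from P_hi[OF F this] show "x \<in> Suc ` lo F" by (auto simp: lo_def) }
  { assume "x \<in> Suc ` lo F"
    then show "x \<in> hi F" using P_lo[OF F] by (auto simp: lo_def hi_def) }
qed

lemma lo_hi: "lo F \<inter> hi F = {}" "lo F \<union> hi F = F"
  by (auto simp: lo_def hi_def)

lemma ini_eq:
  assumes F: "F \<in> P"
  obtains r where "ini F = {1..r}" "even r" "Suc r \<notin> F" "r < N" "{1..r} \<subseteq> F"
proof -
  have ex: "\<exists>t\<ge>1. t \<notin> F"
    using P_D(1)[OF F] by (intro exI[of _ "Suc N"]) auto
  define g where "g = (LEAST t. t \<ge> 1 \<and> t \<notin> F)"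
  have g: "g \<ge> 1" "g \<notin> F" using LeastI_ex[OF ex] by (auto simp: g_def)
  have gm: "t \<in> F" if "1 \<le> t" "t < g" for t
    using not_less_Least[of t "\<lambda>t. t \<ge> 1 \<and> t \<notin> F"] that by (auto simp: g_def)
  obtain r where r: "g = Suc r" using g by (cases g) auto
  have sub: "{1..r} \<subseteq> F" using gm r by auto
  have "r \<le> card F" using card_mono[OF P_D(2)[OF F] sub] by simp
  then have rN: "r < N" using P_D(3)[OF F] Nk by linarith
  have "cnt F (Suc r) = r" using cnt_initial[OF P_D(1)[OF F] sub] by simp
  then have "even r" using P_D(5)[OF F, of "Suc r"] g r rN by auto
  moreover have "ini F = {1..r}"
  proof (intro set_eqI iffI)
    fix x assume x: "x \<in> ini F"
    then have "1 \<le> x" using P_D(4)[OF F] by (cases x) (auto simp: ini_def)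
    moreover have "\<not> Suc r \<le> x"
    proof
      assume "Suc r \<le> x"
      then have "Suc r \<in> {1..x}" by simp
      then have "Suc r \<in> F" using x unfolding ini_def by blast
      then show False using g r by simp
    qed
    ultimately show "x \<in> {1..r}" by auto
  next
    fix x assume "x \<in> {1..r}"
    then show "x \<in> ini F" using sub by (auto simp: ini_def)
  qed
  ultimately show ?thesis using that g r rN sub by blast
qed

text \<open>The two elements of a pair differ by one, so a cell is pinned down by half of its elements
  up to the sign of these differences.\<close>

definition ptn :: "nat set \<Rightarrow> nat \<Rightarrow> nat" where
  "ptn F x = (if even (cnt F x) then Suc x else x - 1)"

lemma ptn_props:
  assumes F: "F \<in> P" and x: "x \<in> F"
  shows "ptn F x \<in> F" "ptn F (ptn F x) = x" "ptn F x = Suc x \<or> x = Suc (ptn F x)"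
proof -
  have "ptn F x \<in> F \<and> ptn F (ptn F x) = x \<and> (ptn F x = Suc x \<or> x = Suc (ptn F x))"
  proof (cases "even (cnt F x)")
    case True
    then show ?thesis using P_lo[OF F x True] by (simp add: ptn_def)
  next
    case False
    from P_hi[OF F x False] show ?thesis using False by (metis diff_Suc_1 ptn_def)
  qed
  then show "ptn F x \<in> F" "ptn F (ptn F x) = x" "ptn F x = Suc x \<or> x = Suc (ptn F x)" by auto
qed

lemma ptn_inj: "F \<in> P \<Longrightarrow> inj_on (ptn F) F"
  by (rule inj_on_inverseI[of _ "ptn F"]) (rule ptn_props)

text \<open>Normal form of a cell for the comparisons below: an initial run up to \<open>r\<close>,
  then the gap \<open>r + 1\<close>, then pairs \<open>{d, Suc d}\<close> with \<open>d\<close> in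
  \<open>D\<close>. The gap is the reason for \<open>r + 2 \<le> d\<close>.\<close>

lemma parts:
  assumes F: "F \<in> P" and r: "ini F = {1..r}" "Suc r \<notin> F" "{1..r} \<subseteq> F"
  defines "D \<equiv> lo F - ini F"
  shows "upper_part F = Suc ` D" "lower_part F = {1..r} \<union> D" "F = {1..r} \<union> D \<union> Suc ` D"
    "{1..r} \<inter> D = {}" "{1..r} \<inter> Suc ` D = {}" "D \<inter> Suc ` D = {}"
    "\<And>d. d \<in> D \<Longrightarrow> r + 2 \<le> d \<and> d < N" "finite D" "r + 2 * card D = 2 * k + 2"
proof -
  have D2: "r + 2 \<le> d \<and> d < N" if "d \<in> D" for d
  proof -
    have dF: "d \<in> F" "d \<notin> {1..r}" "even (cnt F d)" using that r by (auto simp: D_def lo_def)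
    then have "d \<noteq> 0" "d \<noteq> Suc r" using P_D(4)[OF F] r by metis+
    moreover have "Suc d \<in> F" using P_lo[OF F] dF by blast
    then have "Suc d \<le> N" using P_D(1)[OF F] by auto
    ultimately show ?thesis using dF(2) by (simp add: not_le)
  qed
  then show "\<And>d. d \<in> D \<Longrightarrow> r + 2 \<le> d \<and> d < N" .
  show 1: "{1..r} \<inter> D = {}" using r by (auto simp: D_def)
  show 2: "{1..r} \<inter> Suc ` D = {}" using D2 by fastforce
  show 3: "D \<inter> Suc ` D = {}"
    using lo_hi(1)[of F] hi_eq[OF F] by (auto simp: D_def)
  show up: "upper_part F = Suc ` D"
  proof (intro set_eqI iffI)
    fix x assume x: "x \<in> upper_part F"
    then obtain y where y: "y \<in> lo F" "x = Suc y" using hi_eq[OF F] by (auto simp: upper_part_def)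
    have "y \<notin> ini F"
    proof
      assume "y \<in> ini F"
      then have "x \<in> {1..Suc r}" using y r by auto
      moreover have "x \<in> F" "x \<notin> {1..r}" using x r by (auto simp: upper_part_def hi_def)
      ultimately show False using r(2) by (metis atLeastAtMost_iff le_SucE)
    qed
    then show "x \<in> Suc ` D" using y by (auto simp: D_def)
  next
    fix x assume "x \<in> Suc ` D"
    then have "x \<in> hi F" "x \<notin> {1..r}" using 2 hi_eq[OF F] by (auto simp only: D_def)
    then show "x \<in> upper_part F" using r by (simp only: upper_part_def) blast
  qed
  show lp: "lower_part F = {1..r} \<union> D" using r by (auto simp: lower_part_def D_def)
  have "F = lower_part F \<union> upper_part F"
    using lo_hi(2)[of F] r by (auto simp: lower_part_def upper_part_def)
  then show Feq: "F = {1..r} \<union> D \<union> Suc ` D" using up lp by simp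
  show fD: "finite D" using P_D(2)[OF F] by (simp add: D_def lo_def)
  have "card F = card ({1..r} \<union> D) + card (Suc ` D)"
    by (subst Feq, rule card_Un_disjoint) (use fD 2 3 in auto)
  also have "card ({1..r} \<union> D) = r + card D"
    using fD 1 by (subst card_Un_disjoint) auto
  also have "card (Suc ` D) = card D" by (simp add: card_image)
  finally show "r + 2 * card D = 2 * k + 2" using P_D(3)[OF F] by simp
qed

lemma wt_parts:
  assumes "F = {1..r} \<union> D \<union> Suc ` D" "{1..r} \<inter> D = {}" "{1..r} \<inter> Suc ` D = {}" "D \<inter> Suc ` D = {}" "finite D"
  shows "\<Sum>F = \<Sum>{1..r} + \<Sum>D + (\<Sum>d\<in>D. Suc d)"
proof -
  have "\<Sum>F = \<Sum>({1..r} \<union> D) + \<Sum>(Suc ` D)"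
    unfolding assms(1) by (rule sum.union_disjoint) (use assms in auto)
  also have "\<Sum>({1..r} \<union> D) = \<Sum>{1..r} + \<Sum>D" by (rule sum.union_disjoint) (use assms in auto)
  also have "\<Sum>(Suc ` D) = (\<Sum>d\<in>D. Suc d)" by (simp add: sum.reindex)
  finally show ?thesis .
qed

text \<open>Elements of different pairs of \<open>F\<close> are never adjacent, so their partners in \<open>F'\<close> are new.\<close>

lemma upper_part_subset:
  assumes F: "F \<in> P" and F': "F' \<in> P" and sub: "upper_part F \<subseteq> F'"
  shows "F' = F \<or> \<Sum>F < \<Sum>F' \<and> (1 \<in> F' \<longrightarrow> 1 \<in> F)"
proof -
  obtain r where r: "ini F = {1..r}" "even r" "Suc r \<notin> F" "r < N" "{1..r} \<subseteq> F"
    using ini_eq[OF F] by blast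
  define D where "D = lo F - ini F"
  note p = parts[OF F r(1,3,5), folded D_def]
  have E: "Suc ` D \<subseteq> F'" using sub p(1) by simp
  \<comment> \<open>The partner of \<open>Suc d\<close> in \<open>F'\<close> is \<open>d\<close>, as
    in \<open>F\<close>, or \<open>d + 2\<close>; passing from \<open>D\<close> to the partners
    never lowers the sum.\<close>
  define q where "q d = ptn F' (Suc d)" for d
  have qF: "q d \<in> F'" "q d = Suc (Suc d) \<or> q d = d" "ptn F' (q d) = Suc d" if "d \<in> D" for d
    using ptn_props[OF F', of "Suc d"] E that by (auto simp: q_def)
  have injq: "inj_on q D"
  proof (rule inj_onI)
    fix x y assume "x \<in> D" "y \<in> D" "q x = q y"
    then show "x = y" using qF(3) by (metis Suc_inject)
  qed
  have disj: "Suc ` D \<inter> q ` D = {}"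
  proof -
    have False if "d \<in> D" "e \<in> D" "Suc d = q e" for d e
    proof -
      have "d \<noteq> Suc e" using that p(6) by auto
      then show False using qF(2)[OF that(2)] that p(6) by auto
    qed
    then show ?thesis by auto
  qed
  \<comment> \<open>The other \<open>r\<close> elements of \<open>F'\<close> have at least the sum
    of \<open>{1..r}\<close>. Equal total sums therefore force \<open>q d = d\<close> throughout and
    \<open>X = {1..r}\<close>.\<close>
  define X where "X = F' - (Suc ` D \<union> q ` D)"
  have sub2: "Suc ` D \<union> q ` D \<subseteq> F'" using E qF by auto
  have cU: "card (Suc ` D \<union> q ` D) = 2 * card D"
    using disj injq p(8) by (simp add: card_Un_disjoint card_image)
  have cX: "card X = r"
    unfolding X_def using sub2 cU p(8,9) P_D(3)[OF F'] by (subst card_Diff_subset) auto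
  have X: "finite X" "0 \<notin> X" using P_D(2,4)[OF F'] by (auto simp: X_def)
  note sX = sum_ge_initial[OF X cX]
  have "\<Sum>F' = \<Sum>(Suc ` D \<union> q ` D) + \<Sum>X"
    unfolding X_def using sum.subset_diff[OF sub2 P_D(2)[OF F'], of "\<lambda>x. x"] by simp
  also have "\<Sum>(Suc ` D \<union> q ` D) = \<Sum>(Suc ` D) + \<Sum>(q ` D)"
    using disj p(8) by (intro sum.union_disjoint) auto
  also have "\<dots> = (\<Sum>d\<in>D. Suc d) + (\<Sum>d\<in>D. q d)"
    using injq by (simp add: sum.reindex)
  finally have s': "\<Sum>F' = (\<Sum>d\<in>D. Suc d) + (\<Sum>d\<in>D. q d) + \<Sum>X" .
  have s: "\<Sum>F = \<Sum>{1..r} + \<Sum>D + (\<Sum>d\<in>D. Suc d)" by (rule wt_parts[OF p(3-6) p(8)])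
  have qge: "d \<le> q d" if "d \<in> D" for d using qF(2)[OF that] by auto
  then have sq: "\<Sum>D \<le> (\<Sum>d\<in>D. q d)" by (intro sum_mono) simp
  show ?thesis
  proof (cases "\<Sum>F < \<Sum>F'")
    case True
    have "1 \<in> F" if one: "1 \<in> F'"
    proof (cases "r = 0")
      case True
      then have "F' = Suc ` D \<union> q ` D" using cX X sub2 by (auto simp: X_def)
      then consider d where "d \<in> D" "1 = Suc d" | d where "d \<in> D" "1 = q d" using one by auto
      then show ?thesis
      proof cases
        case 1
        then show ?thesis using p(7)[of d] by simp
      next
        case (2 d)
        have "d = 1" using qF(2)[OF 2(1)] 2 by auto
        then show ?thesis using 2 p(3) by auto
      qed
    qed (use r in auto)
    with True show ?thesis by simp
  next
    case False
    then have eq: "\<Sum>X = \<Sum>{1..r}" "\<Sum>D = (\<Sum>d\<in>D. q d)" using s s' sX sq by linarith+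
    have "q d = d" if "d \<in> D" for d
      using sum_mono_inv[OF eq(2) qge that p(8)] by simp
    then have "q ` D = D" by auto
    then have "F' = {1..r} \<union> D \<union> Suc ` D" using sX eq(1) sub2 by (auto simp: X_def)
    then show ?thesis using p(3) by simp
  qed
qed

text \<open>The partner in \<open>F'\<close> of an element \<open>d\<close> of \<open>D\<close> is
  \<open>d + 1\<close> or \<open>d - 1\<close>. These partners are new, and with the run and
  \<open>D\<close> they exhaust \<open>F'\<close> by cardinality. So the sum is at most that of
  \<open>F\<close>, with equality only if every partner is \<open>d + 1\<close>.\<close>

lemma lower_part_subset:
  assumes F: "F \<in> P" and F': "F' \<in> P" and sub: "lower_part F \<subseteq> F'"
  shows "F' = F \<or> \<Sum>F' < \<Sum>F \<and> (1 \<in> F \<longrightarrow> 1 \<in> F')"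
proof -
  obtain r where r: "ini F = {1..r}" "even r" "Suc r \<notin> F" "r < N" "{1..r} \<subseteq> F"
    using ini_eq[OF F] by blast
  define D where "D = lo F - ini F"
  note p = parts[OF F r(1,3,5), folded D_def]
  have E: "{1..r} \<subseteq> F'" "D \<subseteq> F'" using sub p(2) by auto
  define q where "q = ptn F'"
  have qF: "q d \<in> F'" "q d = Suc d \<or> d = Suc (q d)" "q (q d) = d" if "d \<in> D" for d
    using ptn_props[OF F', of d] E that by (auto simp: q_def)
  have injq: "inj_on q D"
    using ptn_inj[OF F'] E(2) unfolding q_def by (rule inj_on_subset)
  have disj: "D \<inter> q ` D = {}"
  proof -
    have False if "d \<in> D" "e \<in> D" "d = q e" for d e
      using qF(2)[OF that(2)] that p(6) by auto
    then show ?thesis by auto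
  qed
  have disj1: "{1..r} \<inter> q ` D = {}"
  proof -
    have "q d > r" if "d \<in> D" for d using qF(2)[OF that] p(7)[OF that] by linarith
    then show ?thesis by fastforce
  qed
  have sub2: "{1..r} \<union> (D \<union> q ` D) \<subseteq> F'" using E qF by auto
  have "card ({1..r} \<union> (D \<union> q ` D)) = r + card (D \<union> q ` D)"
    using disj1 p(4,8) by (subst card_Un_disjoint) auto
  also have "card (D \<union> q ` D) = card D + card (q ` D)"
    using disj p(8) by (intro card_Un_disjoint) auto
  finally have "card ({1..r} \<union> (D \<union> q ` D)) = card F'"
    using p(9) P_D(3)[OF F'] injq by (simp add: card_image)
  then have F'eq: "F' = {1..r} \<union> (D \<union> q ` D)"
    using card_subset_eq[OF P_D(2)[OF F'] sub2] by simp
  have "\<Sum>F' = \<Sum>{1..r} + \<Sum>(D \<union> q ` D)"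
    unfolding F'eq using disj1 p(4,8) by (intro sum.union_disjoint) auto
  also have "\<Sum>(D \<union> q ` D) = \<Sum>D + \<Sum>(q ` D)"
    using disj p(8) by (intro sum.union_disjoint) auto
  also have "\<Sum>(q ` D) = (\<Sum>d\<in>D. q d)" using injq by (simp add: sum.reindex)
  finally have s': "\<Sum>F' = \<Sum>{1..r} + (\<Sum>D + (\<Sum>d\<in>D. q d))" .
  have s: "\<Sum>F = \<Sum>{1..r} + \<Sum>D + (\<Sum>d\<in>D. Suc d)" by (rule wt_parts[OF p(3-6) p(8)])
  have qle: "q d \<le> Suc d" if "d \<in> D" for d using qF(2)[OF that] by auto
  then have sq: "(\<Sum>d\<in>D. q d) \<le> (\<Sum>d\<in>D. Suc d)" by (intro sum_mono) simp
  have "1 \<in> F'" if "1 \<in> F"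
  proof -
    have "1 \<in> ini F" using that by (auto simp: ini_def)
    then show ?thesis using E(1) r(1) by blast
  qed
  moreover have "F' = F" if "\<not> \<Sum>F' < \<Sum>F"
  proof -
    have eq: "(\<Sum>d\<in>D. q d) = (\<Sum>d\<in>D. Suc d)" using s s' sq that by linarith
    have "q d = Suc d" if "d \<in> D" for d
      using sum_mono_inv[OF eq qle that p(8)] by simp
    then have "q ` D = Suc ` D" by auto
    then show ?thesis using F'eq p(3) by auto
  qed
  ultimately show ?thesis by blast
qed

text \<open>In a cell of \<open>W\<close> gaps need odd counts. Containing \<open>{1..r}\<close>
  with \<open>r\<close> even thus forces \<open>r + 1\<close> and also \<open>N\<close>, and every
  element of \<open>D\<close> still brings a partner of its own. That makes \<open>2 * k + 4\<close>
  elements, two too many.\<close>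

lemma lower_part_not_subset_W:
  assumes F: "F \<in> P" and F': "F' \<in> W" and sub: "lower_part F \<subseteq> F'"
  shows False
proof -
  obtain r where r: "ini F = {1..r}" "even r" "Suc r \<notin> F" "r < N" "{1..r} \<subseteq> F"
    using ini_eq[OF F] by blast
  define D where "D = lo F - ini F"
  note p = parts[OF F r(1,3,5), folded D_def]
  have E: "{1..r} \<subseteq> F'" "D \<subseteq> F'" using sub p(2) by auto
  note f = W_D(1-3)[OF F'] and gap = W_D(5)[OF F']
  note cS = cnt_Suc[OF f(2)]
  have "cnt F' (Suc r) = r" using cnt_initial[OF f(1) E(1)] by simp
  then have Sr: "Suc r \<in> F'" using gap[of "Suc r"] r by auto
  have S1: "{1..Suc r} \<subseteq> F'" using E(1) Sr by (auto simp: le_Suc_eq)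
  have N: "N \<in> F'"
  proof (rule ccontr)
    assume "N \<notin> F'"
    then have "cnt F' N = 2 * k + 2" using cS[of N] cnt_all[OF f(1)] f(3) by simp
    then show False using gap[of N] \<open>N \<notin> F'\<close> Nk by simp
  qed
  \<comment> \<open>Compared with \<open>ptn\<close> the parities are exchanged: the vertex 1 is
    paired with \<open>N\<close>, so the remaining pairs start at odd counts.\<close>
  define q where "q d = (if even (cnt F' d) then d - 1 else Suc d)" for d
  have q: "q d \<in> F' \<and> Suc r < q d \<and> q d < N \<and> (d = Suc (q d) \<and> odd (cnt F' (q d)) \<or> q d = Suc d \<and> odd (cnt F' d))"
    if d: "d \<in> D" for d
  proof (cases "even (cnt F' d)")
    case True
    obtain c where c: "d = Suc c" "Suc r \<le> c" using p(7)[OF d] by (cases d) auto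
    have "c \<in> F'"
    proof (rule ccontr)
      assume "c \<notin> F'"
      then have "odd (cnt F' c)" "cnt F' d = cnt F' c" using gap[of c] c p(7)[OF d] cS[of c] by auto
      then show False using True by simp
    qed
    moreover have "c \<noteq> Suc r"
    proof
      assume "c = Suc r"
      then have "cnt F' d = Suc r" using cnt_initial[OF f(1) S1, of d] c by simp
      then show False using True r(2) by simp
    qed
    moreover have "odd (cnt F' c)" using True c cS[of c] \<open>c \<in> F'\<close> by simp
    ultimately show ?thesis using True c p(7)[OF d] by (simp add: q_def)
  next
    case False
    have dF: "d \<in> F'" using E d by blast
    then have ev: "even (cnt F' (Suc d))" using False cS[of d] by simp
    have dN: "Suc d \<le> N" using p(7)[OF d] by simp
    have "Suc d \<in> F'"
      by (rule ccontr) (use gap[of "Suc d"] ev dN in auto)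
    moreover have "Suc d \<noteq> N"
    proof
      assume e: "Suc d = N"
      have "cnt F' (Suc N) = cnt F' N + 1" using cS[of N] N by simp
      then have "cnt F' N + 1 = 2 * k + 2" using cnt_all[OF f(1)] f(3) by simp
      then have "odd (cnt F' N)" by presburger
      then show False using ev e by simp
    qed
    ultimately show ?thesis using False dN p(7)[OF d] by (simp add: q_def)
  qed
  have nadj: "d \<noteq> Suc e" if "d \<in> D" "e \<in> D" for d e using that p(6) by auto
  have injq: "inj_on q D"
  proof (rule inj_onI)
    fix x y assume xy: "x \<in> D" "y \<in> D" "q x = q y"
    have "odd (cnt F' (Suc x)) \<longleftrightarrow> even (cnt F' x)" "odd (cnt F' (Suc y)) \<longleftrightarrow> even (cnt F' y)"
      using cS E(2) xy by auto
    then show "x = y" using q[OF xy(1)] q[OF xy(2)] xy(3) by auto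
  qed
  have disj: "D \<inter> q ` D = {}"
  proof -
    have False if "d \<in> D" "e \<in> D" "d = q e" for d e
      using q[OF that(2)] that nadj[of d e] nadj[of e d] by auto
    then show ?thesis by auto
  qed
  let ?B = "insert N {1..Suc r}"
  have disjB: "?B \<inter> (D \<union> q ` D) = {}"
  proof -
    have "d \<notin> ?B" "q d \<notin> ?B" if "d \<in> D" for d using p(7)[OF that] q[OF that] by auto
    then show ?thesis by blast
  qed
  have "card (?B \<union> (D \<union> q ` D)) = card ?B + (card D + card (q ` D))"
    using disj disjB p(8) by (simp add: card_Un_disjoint del: Un_insert_left)
  also have "card (q ` D) = card D" using injq by (simp add: card_image)
  also have "card ?B = r + 2"
  proof -
    have "N \<noteq> Suc r" using N p(9) f Nk r(4)
    proof -
      have "r \<le> 2 * k + 2" using p(9) by linarith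
      then show ?thesis using Nk by linarith
    qed
    then show ?thesis using r(4) by simp
  qed
  finally have "card (?B \<union> (D \<union> q ` D)) = 2 * k + 4" using p(9) by simp
  moreover have "?B \<union> (D \<union> q ` D) \<subseteq> F'" using S1 N E(2) q by auto
  ultimately have "2 * k + 4 \<le> card F'" using card_mono[OF f(2)] by metis
  then show False using f(3) by simp
qed

lemma max_gap:
  assumes "Q \<subseteq> {1..N} - F" "Q \<noteq> {}"
  obtains g where "g \<in> Q" "\<And>t. t \<in> Q \<Longrightarrow> t \<le> g"
  using assms finite_subset[OF assms(1)] Max_in Max_ge by (metis finite_Diff finite_atLeastAtMost)

lemma min_gap:
  assumes "Q \<subseteq> {1..N} - F" "Q \<noteq> {}"
  obtains g where "g \<in> Q" "\<And>t. t \<in> Q \<Longrightarrow> g \<le> t"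
  using assms finite_subset[OF assms(1)] Min_in Min_le by (metis finite_Diff finite_atLeastAtMost)

text \<open>A ridge is obtained by dropping \<open>u\<close>; the cell on its other side contains the gap at the end
  of that part of the run of \<open>u\<close> which has become odd.\<close>

lemma lower_neighbour:
  assumes F: "F \<in> P" and u: "u \<in> upper_part F"
  shows "\<exists>F'\<in>P. F - {u} \<subseteq> F' \<and> \<Sum>F' < \<Sum>F \<and> (1 \<in> F \<longrightarrow> 1 \<in> F')"
proof -
  note f = P_D[OF F]
  have uF: "u \<in> F" "odd (cnt F u)" "u \<notin> ini F" using u by (auto simp: upper_part_def hi_def)
  then have uN: "u \<in> {1..N}" using f(1) by blast
  define Q where "Q = {t. 1 \<le> t \<and> t < u \<and> t \<notin> F}"
  have "Q \<noteq> {}"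
  proof
    assume "Q = {}"
    have "x \<in> F" if "x \<in> {1..u}" for x
      using that uF(1) \<open>Q = {}\<close> by (cases "x = u") (auto simp: Q_def)
    then have "{1..u} \<subseteq> F" by blast
    then show False using uF by (auto simp: ini_def)
  qed
  moreover have "Q \<subseteq> {1..N} - F" using uN by (auto simp: Q_def)
  ultimately obtain g where g: "g \<in> Q" "\<And>t. t \<in> Q \<Longrightarrow> t \<le> g" using max_gap by metis
  then have g': "1 \<le> g" "g < u" "g \<notin> F" by (auto simp: Q_def)
  let ?F = "insert g (F - {u})"
  note sw = cnt_swap[OF f(2) uF(1) g'(3)]
  have "even (cnt ?F t)" if t: "t \<in> {1..N}" "t \<notin> ?F" for t
  proof (cases "t = u")
    case True
    then show ?thesis using sw[of u] g' uF(2) by simp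
  next
    case False
    then have "t \<notin> F" "t \<noteq> g" using t by auto
    then have "(u < t) = (g < t)" using g(2)[of t] t False g' by (cases t u rule: linorder_cases) (auto simp: Q_def)
    then show ?thesis using sw[of t] f(5)[OF t(1) \<open>t \<notin> F\<close>] by simp
  qed
  then have "?F \<in> P"
    using f card_swap[OF f(2) uF(1) g'(3)] g' uN by (auto simp: P_def)
  moreover have "\<Sum>?F < \<Sum>F" using sum_swap[OF f(2) uF(1) g'(3)] g'(2) by linarith
  moreover have "u \<noteq> 1" using uF(2) cnt_one[OF f(1)] by (metis even_zero)
  ultimately show ?thesis by (intro bexI[of _ ?F]) auto
qed

text \<open>The dropped element is exchanged for a cyclically next gap. A smaller member of a pair
  goes to the next gap above or, if there is none, past \<open>N\<close> to the first gap; a larger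
  member in the initial run goes down past 1 to the last gap. Going around changes the parity at all
  remaining gaps, which leads into \<open>W\<close>.\<close>

lemma upper_neighbour:
  assumes F: "F \<in> P" and u: "u \<in> lower_part F"
  shows "\<exists>F'. F - {u} \<subseteq> F' \<and> (F' \<in> W \<or> F' \<in> P \<and> \<Sum>F < \<Sum>F' \<and> (1 \<in> F' \<longrightarrow> 1 \<in> F))"
proof -
  note f = P_D[OF F]
  have uF: "u \<in> F" using u by (auto simp: lower_part_def lo_def ini_def)
  then have uN: "u \<in> {1..N}" using f(1) by blast
  define Q where "Q = {t. u < t \<and> t \<le> N \<and> t \<notin> F}"
  define Q' where "Q' = {t. 1 \<le> t \<and> t < u \<and> t \<notin> F}"
  have QN: "Q \<subseteq> {1..N} - F" "Q' \<subseteq> {1..N} - F" using uN by (auto simp: Q_def Q'_def)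
  have QQ: "t \<in> Q \<or> t \<in> Q'" if "t \<in> {1..N}" "t \<notin> F" for t
    using that uF by (cases t u rule: linorder_cases) (auto simp: Q_def Q'_def)
  have ne: "Q \<union> Q' \<noteq> {}"
  proof -
    have "F \<noteq> {1..N}" using f(3) Nk by auto
    then show ?thesis using QQ f(1) by blast
  qed
  show ?thesis
  proof (cases "even (cnt F u)")
    case ev: True
    show ?thesis
    proof (cases "Q = {}")
      case False
      then obtain g where g: "g \<in> Q" "\<And>t. t \<in> Q \<Longrightarrow> g \<le> t" using min_gap QN by metis
      then have g': "u < g" "g \<le> N" "g \<notin> F" by (auto simp: Q_def)
      let ?F = "insert g (F - {u})"
      note sw = cnt_swap[OF f(2) uF g'(3)]
      have "even (cnt ?F t)" if t: "t \<in> {1..N}" "t \<notin> ?F" for t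
      proof (cases "t = u")
        case True
        then show ?thesis using sw[of u] g' ev by simp
      next
        case False
        then have "t \<notin> F" "t \<noteq> g" using t by auto
        then have "(u < t) = (g < t)" using g(2)[of t] t False g' by (cases t u rule: linorder_cases) (auto simp: Q_def)
        then show ?thesis using sw[of t] f(5)[OF t(1) \<open>t \<notin> F\<close>] by simp
      qed
      then have "?F \<in> P"
        using f card_swap[OF f(2) uF g'(3)] g' uN by (auto simp: P_def)
      moreover have "\<Sum>F < \<Sum>?F" using sum_swap[OF f(2) uF g'(3)] g'(1) by linarith
      moreover have "1 \<in> ?F \<longrightarrow> 1 \<in> F" using g'(1) uN by auto
      ultimately show ?thesis by (intro exI[of _ ?F]) auto
    next
      case True
      then obtain g where g: "g \<in> Q'" "\<And>t. t \<in> Q' \<Longrightarrow> g \<le> t" using min_gap QN ne by (metis Un_empty)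
      then have g': "1 \<le> g" "g < u" "g \<notin> F" by (auto simp: Q'_def)
      let ?F = "insert g (F - {u})"
      note sw = cnt_swap[OF f(2) uF g'(3)]
      have "odd (cnt ?F t)" if t: "t \<in> {1..N}" "t \<notin> ?F" for t
      proof (cases "t = u")
        case True
        then show ?thesis using sw[of u] g' ev by simp
      next
        case False
        then have tF: "t \<notin> F" "t \<noteq> g" using t by auto
        then have "t \<in> Q'" using QQ t True by blast
        then have "g < t" "t < u" using g(2)[of t] tF by (auto simp: Q'_def)
        then show ?thesis using sw[of t] f(5)[OF t(1) tF(1)] by simp
      qed
      then have "?F \<in> W"
        using f card_swap[OF f(2) uF g'(3)] g' uN by (auto simp: W_def)
      then show ?thesis by (intro exI[of _ ?F]) auto
    qed
  next
    case od: False
    then have ui: "{1..u} \<subseteq> F" using u by (auto simp: lower_part_def lo_def ini_def)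
    then have "Q' = {}" by (auto simp: Q'_def)
    then obtain g where g: "g \<in> Q" "\<And>t. t \<in> Q \<Longrightarrow> t \<le> g" using max_gap QN ne by (metis Un_empty)
    then have g': "u < g" "g \<le> N" "g \<notin> F" by (auto simp: Q_def)
    let ?F = "insert g (F - {u})"
    note sw = cnt_swap[OF f(2) uF g'(3)]
    have "odd (cnt ?F t)" if t: "t \<in> {1..N}" "t \<notin> ?F" for t
    proof (cases "t = u")
      case True
      then show ?thesis using sw[of u] g' od by simp
    next
      case False
      then have tF: "t \<notin> F" "t \<noteq> g" using t by auto
      then have "t \<in> Q" using QQ t \<open>Q' = {}\<close> by blast
      then have "t < g" "u < t" using g(2)[of t] tF by (auto simp: Q_def)
      then show ?thesis using sw[of t] f(5)[OF t(1) tF(1)] by (simp add: Suc_eq_plus1[symmetric]) presburger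
    qed
    then have "?F \<in> W"
      using f card_swap[OF f(2) uF g'(3)] g' uN by (auto simp: W_def)
    then show ?thesis by (intro exI[of _ ?F]) auto
  qed
qed

lemma parts_partition:
  "lower_part F \<union> upper_part F = F" "lower_part F \<inter> upper_part F = {}"
  by (auto simp: lower_part_def upper_part_def lo_def hi_def ini_def)

section \<open>The order of the cells\<close>

text \<open>Cells containing \<open>1\<close> come first, then cells are ordered by their sum.\<close>

definition rk :: "nat set \<Rightarrow> nat" where
  "rk F = \<Sum>F + (if 1 \<in> F then 0 else Suc (\<Sum>{1..N}))"

lemma sum_le_total: "F \<in> P \<Longrightarrow> \<Sum>F \<le> \<Sum>{1..N}"
  by (intro sum_mono2) (auto simp: P_def)

lemma rk_less: "\<Sum>F < \<Sum>F' \<Longrightarrow> (1 \<in> F' \<longrightarrow> 1 \<in> F) \<Longrightarrow> rk F < rk F'"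
  by (auto simp: rk_def)

lemma upper_part_rk: "F \<in> P \<Longrightarrow> F' \<in> P \<Longrightarrow> upper_part F \<subseteq> F' \<Longrightarrow> F' = F \<or> rk F < rk F'"
  using upper_part_subset rk_less by blast

lemma lower_part_rk: "F \<in> P \<Longrightarrow> F' \<in> P \<Longrightarrow> lower_part F \<subseteq> F' \<Longrightarrow> F' = F \<or> rk F' < rk F"
  using lower_part_subset rk_less by blast

lemma lower_neighbour_rk: "F \<in> P \<Longrightarrow> u \<in> upper_part F \<Longrightarrow> \<exists>F'\<in>P. F - {u} \<subseteq> F' \<and> rk F' < rk F"
  using lower_neighbour rk_less by blast

lemma upper_neighbour_rk:
  "F \<in> P \<Longrightarrow> u \<in> lower_part F \<Longrightarrow> \<exists>F'. F - {u} \<subseteq> F' \<and> (F' \<in> W \<or> F' \<in> P \<and> rk F < rk F')"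
  using upper_neighbour rk_less by meson

abbreviation first_cell :: "nat set" where "first_cell \<equiv> {1..2 * k + 2}"

lemma first_cell_P: "first_cell \<in> P" and ini_first_cell: "ini first_cell = first_cell"
proof -
  have "even (cnt first_cell t)" if "t \<in> {1..N} - first_cell" for t
  proof -
    have "first_cell \<inter> {..<t} = first_cell" using that by auto
    then show ?thesis by (simp add: cnt_def)
  qed
  then show "first_cell \<in> P" using Nk by (auto simp: P_def)
  show "ini first_cell = first_cell" by (auto simp: ini_def)
qed

lemma first_cell_parts: "upper_part first_cell = {}" "lower_part first_cell = first_cell"
  unfolding upper_part_def lower_part_def ini_first_cell by (auto simp: hi_def lo_def)

text \<open>The upper part of this cell is empty, hence contained in every cell.\<close>

lemma first_cell_rk: "F \<in> P \<Longrightarrow> F \<noteq> first_cell \<Longrightarrow> rk first_cell < rk F"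
  using upper_part_rk[OF first_cell_P, of F] first_cell_parts by simp

lemma parts_nonempty:
  assumes F: "F \<in> P" "F \<noteq> first_cell"
  shows "upper_part F \<noteq> {}" "lower_part F \<noteq> {}"
proof -
  show "upper_part F \<noteq> {}"
    using upper_part_rk[OF F(1) first_cell_P] first_cell_rk[OF F] F(2) by (metis empty_subsetI less_asym)
  have "F \<noteq> {}" using P_D(3)[OF F(1)] by auto
  then have "lo F \<noteq> {}" using hi_eq[OF F(1)] lo_hi(2)[of F] by auto
  then show "lower_part F \<noteq> {}" by (simp add: lower_part_def)
qed

text \<open>Closure is required only for strictly smaller rank, so cells of the top rank may be
  chosen freely. The whole count comes from this freedom.\<close>

definition ideal :: "nat set set \<Rightarrow> bool" where
  "ideal L \<longleftrightarrow> L \<subseteq> P \<and> first_cell \<in> L \<and> (\<forall>F\<in>L. \<forall>F'\<in>P. rk F' < rk F \<longrightarrow> F' \<in> L)"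

section \<open>Squeezed balls\<close>

text \<open>The induction removes a cell \<open>F\<close> of greatest rank. Other cells of
  \<open>P\<close> containing its upper part have strictly larger rank, those containing its lower
  part strictly smaller rank; cells tied with \<open>F\<close>, on either side, thus never obstruct
  the move.\<close>

theorem spheres_ideal:
  assumes "ideal L" and v: "v \<notin> {1..N}"
  shows "spheres (2 * k) v L ((P - L) \<union> W)"
  using assms(1)
proof (induction "card L" arbitrary: L rule: less_induct)
  case less
  have L: "L \<subseteq> P" "first_cell \<in> L" "\<And>F F'. F \<in> L \<Longrightarrow> F' \<in> P \<Longrightarrow> rk F' < rk F \<Longrightarrow> F' \<in> L"
    using less.prems unfolding ideal_def by blast+
  have fL: "finite L" using L(1) finite_P finite_subset by blast
  have "Max (rk ` L) \<in> rk ` L" using fL L(2) by (intro Max_in) auto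
  then obtain F where F: "F \<in> L" "rk F = Max (rk ` L)" by (metis imageE)
  have F: "F \<in> L" "\<And>F'. F' \<in> L \<Longrightarrow> rk F' \<le> rk F"
    using F fL by (simp_all add: Max_ge)
  have FP: "F \<in> P" using F L by blast
  have low: "lower_part F \<notin> down ((P - L) \<union> W)"
  proof
    assume "lower_part F \<in> down ((P - L) \<union> W)"
    then obtain F' where F': "lower_part F \<subseteq> F'" "F' \<in> P - L \<or> F' \<in> W" by (auto simp: down_def)
    then have "F' \<in> P - L" using lower_part_not_subset_W[OF FP] by blast
    then show False using lower_part_rk[OF FP, of F'] F'(1) F(1) L(3) by blast
  qed
  have lown: "F - {u} \<in> down ((P - L) \<union> W)" if u: "u \<in> lower_part F" for u
  proof -
    obtain F' where F': "F - {u} \<subseteq> F'" "F' \<in> W \<or> F' \<in> P \<and> rk F < rk F'"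
      using upper_neighbour_rk[OF FP u] by blast
    then have "F' \<in> (P - L) \<union> W" using F(2)[of F'] by auto
    then show ?thesis by (rule downI[OF F'(1)])
  qed
  show ?case
  proof (cases "F = first_cell")
    case True
    have "F' = first_cell" if "F' \<in> L" for F'
    proof (rule ccontr)
      assume "F' \<noteq> first_cell"
      with that L(1) have "rk F < rk F'" using first_cell_rk[of F'] True by blast
      then show False using F(2)[OF that] by simp
    qed
    then have "L = {first_cell}" using L(2) by blast
    then show ?thesis
      using low lown first_cell_parts True v Nk by (auto intro!: spheres_simplex)
  next
    case False
    have m: "cell_move (lower_part F) (upper_part F) (L - {F}) ((P - L) \<union> W)"
      unfolding cell_move_def parts_partition
    proof (intro conjI ballI)
      show "finite (lower_part F)" "finite (upper_part F)"
        using P_D(2)[OF FP] parts_partition(1)[of F] by (metis finite_Un)+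
      show "lower_part F \<noteq> {}" "upper_part F \<noteq> {}" using parts_nonempty[OF FP False] by auto
      show "upper_part F \<notin> down (L - {F})"
      proof
        assume "upper_part F \<in> down (L - {F})"
        then obtain F' where "upper_part F \<subseteq> F'" "F' \<in> L" "F' \<noteq> F" by (auto simp: down_def)
        then show False using upper_part_rk[OF FP, of F'] F(2)[of F'] L(1) by auto
      qed
      show "F - {u} \<in> down (L - {F})" if u: "u \<in> upper_part F" for u
      proof -
        obtain F' where F': "F' \<in> P" "F - {u} \<subseteq> F'" "rk F' < rk F"
          using lower_neighbour_rk[OF FP u] by blast
        then have "F' \<in> L - {F}" using L(3)[OF F(1)] by auto
        then show ?thesis by (rule downI[OF F'(2)])
      qed
    qed (use low lown parts_partition in auto)
    have "ideal (L - {F})"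
      unfolding ideal_def
    proof (intro conjI ballI impI)
      show "first_cell \<in> L - {F}" using L(2) False by blast
      show "F2 \<in> L - {F}" if "F1 \<in> L - {F}" "F2 \<in> P" "rk F2 < rk F1" for F1 F2
        using L(3)[of F1 F2] F(2)[of F1] that by auto
    qed (use L in blast)
    moreover have "card (L - {F}) < card L" by (rule card_Diff1_less[OF fL F(1)])
    ultimately have s: "spheres (2 * k) v (L - {F}) ((P - (L - {F})) \<union> W)" using less.hyps by blast
    have "(P - (L - {F})) \<union> W = insert F ((P - L) \<union> W)" using FP F(1) by blast
    with s have s': "spheres (2 * k) v (L - {F}) (insert F ((P - L) \<union> W))" by (simp only:)
    have "v \<notin> F" using v P_D(1)[OF FP] by blast
    from spheres_move[OF m, unfolded parts_partition, OF this s']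
    show ?thesis by (simp only: insert_Diff[OF F(1)])
  qed
qed

section \<open>Cells covering small vertex sets\<close>

text \<open>\<open>P\<close> with an arbitrary number \<open>j\<close> of pairs, to permit induction
  on \<open>j\<close>.\<close>

definition even_sets :: "nat \<Rightarrow> nat set set" where
  "even_sets j = {F. F \<subseteq> {1..N} \<and> card F = 2 * j \<and> (\<forall>t\<in>{1..N} - F. even (cnt F t))}"

lemma P_eq_even_sets: "P = even_sets (k + 1)"
  by (auto simp: P_def even_sets_def)

text \<open>\<open>a\<close> and \<open>b\<close> are consecutive gaps, so every other gap counts
  both of them or neither.\<close>

lemma even_sets_insert_gaps:
  assumes F: "F \<in> even_sets j" and ab: "1 \<le> a" "a < b" "b \<le> N" "a \<notin> F" "b \<notin> F"
    and gaps: "\<And>t. t \<in> {1..N} \<Longrightarrow> t \<notin> F \<Longrightarrow> t \<le> a \<or> b \<le> t"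
  shows "insert a (insert b F) \<in> even_sets (j + 1)"
proof -
  have f: "F \<subseteq> {1..N}" "card F = 2 * j" "\<And>t. t \<in> {1..N} \<Longrightarrow> t \<notin> F \<Longrightarrow> even (cnt F t)"
    using F by (auto simp: even_sets_def)
  have fin: "finite F" using f(1) finite_subset by blast
  have "even (cnt (insert a (insert b F)) t)" if "t \<in> {1..N} - insert a (insert b F)" for t
  proof -
    have t: "t \<in> {1..N}" "t \<notin> F" "t \<noteq> a" "t \<noteq> b" using that by auto
    then have "a < t \<longleftrightarrow> b < t" using gaps[of t] ab by auto
    then show ?thesis using ab fin f(3)[OF t(1,2)] by (simp add: cnt_insert)
  qed
  then show ?thesis using f ab fin by (auto simp: even_sets_def)
qed

text \<open>A new point is added together with the next gap above it or, if there is none, the next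
  gap below. If \<open>g\<close> is already covered, any gap takes its place.\<close>

lemma even_sets_extend:
  assumes F: "F \<in> even_sets j" and j: "2 * j + 2 \<le> N" and g: "g \<in> {1..N}"
  shows "\<exists>F'\<in>even_sets (j + 1). insert g F \<subseteq> F'"
proof -
  have f: "F \<subseteq> {1..N}" "card F = 2 * j" using F by (auto simp: even_sets_def)
  have fin: "finite F" using f(1) finite_subset by blast
  have cg: "card ({1..N} - F) = N - 2 * j" using f fin by (simp add: card_Diff_subset)
  obtain a where a: "a \<in> {1..N} - F" "insert g F \<subseteq> insert a F"
  proof (cases "g \<in> F")
    case True
    have "card ({1..N} - F) \<noteq> 0" using cg j by linarith
    then have "{1..N} - F \<noteq> {}" by (metis card.empty)
    then show ?thesis using that True by blast
  qed (use that g in blast)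
  define X where "X = {t \<in> {1..N} - F. a < t}"
  define Y where "Y = {t \<in> {1..N} - F. t < a}"
  have XY: "X \<subseteq> {1..N} - F" "Y \<subseteq> {1..N} - F" by (auto simp: X_def Y_def)
  have "X \<union> Y \<noteq> {}"
  proof
    assume "X \<union> Y = {}"
    have "t = a" if "t \<in> {1..N} - F" for t
    proof -
      have "t \<notin> X" "t \<notin> Y" using \<open>X \<union> Y = {}\<close> by auto
      then show ?thesis using that by (auto simp: X_def Y_def)
    qed
    then have "{1..N} - F \<subseteq> {a}" by blast
    then have "card ({1..N} - F) \<le> 1" using card_mono[of "{a}" "{1..N} - F"] by simp
    then show False using cg j by linarith
  qed
  then consider "X \<noteq> {}" | "Y \<noteq> {}" by blast
  then show ?thesis
  proof cases
    case 1
    then obtain b where b: "b \<in> X" "\<And>t. t \<in> X \<Longrightarrow> b \<le> t" using min_gap[OF XY(1)] by metis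
    have "insert a (insert b F) \<in> even_sets (j + 1)"
    proof (rule even_sets_insert_gaps[OF F])
      show "t \<le> a \<or> b \<le> t" if "t \<in> {1..N}" "t \<notin> F" for t
        using b(2)[of t] that by (cases "a < t") (auto simp: X_def)
    qed (use a(1) b(1) in \<open>auto simp: X_def\<close>)
    then show ?thesis using a(2) by (intro bexI[of _ "insert a (insert b F)"]) auto
  next
    case 2
    then obtain b where b: "b \<in> Y" "\<And>t. t \<in> Y \<Longrightarrow> t \<le> b" using max_gap[OF XY(2)] by metis
    have "insert b (insert a F) \<in> even_sets (j + 1)"
    proof (rule even_sets_insert_gaps[OF F])
      show "t \<le> b \<or> a \<le> t" if "t \<in> {1..N}" "t \<notin> F" for t
        using b(2)[of t] that by (cases "t < a") (auto simp: Y_def)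
    qed (use a(1) b(1) in \<open>auto simp: Y_def\<close>)
    then show ?thesis using a(2) by (intro bexI[of _ "insert b (insert a F)"]) auto
  qed
qed

lemma even_sets_cover:
  assumes "2 * j \<le> N" "G \<subseteq> {1..N}" "card G \<le> j"
  shows "\<exists>F\<in>even_sets j. G \<subseteq> F"
  using assms
proof (induction j arbitrary: G)
  case 0
  then have "G = {}" using finite_subset[OF 0(2)] by simp
  moreover have "{} \<in> even_sets 0" by (simp add: even_sets_def cnt_def)
  ultimately show ?case by blast
next
  case (Suc j)
  have fin: "finite G" using Suc.prems(2) finite_subset by blast
  obtain g where g: "g \<in> {1..N}" "G = {} \<or> g \<in> G"
  proof (cases "G = {}")
    case True
    then show ?thesis using that[of 1] Suc.prems(1) by simp
  next
    case False
    then obtain g where "g \<in> G" by blast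
    then show ?thesis using that[of g] Suc.prems(2) by blast
  qed
  have "card (G - {g}) \<le> j" using Suc.prems(3) g fin by (cases "G = {}") auto
  moreover have "2 * j \<le> N" "G - {g} \<subseteq> {1..N}" using Suc.prems(1,2) by auto
  ultimately obtain F where F: "F \<in> even_sets j" "G - {g} \<subseteq> F" using Suc.IH by blast
  then obtain F' where "F' \<in> even_sets (j + 1)" "insert g F \<subseteq> F'"
    using even_sets_extend[OF F(1) _ g(1)] Suc.prems(1) by auto
  then show ?case using F(2) by (intro bexI[of _ F']) auto
qed

lemma card_lo: "F \<in> P \<Longrightarrow> card (lo F) = k + 1" and card_hi: "F \<in> P \<Longrightarrow> card (hi F) = k + 1"
proof -
  assume F: "F \<in> P"
  have "card F = card (lo F) + card (hi F)"
    using card_Un_disjoint[of "lo F" "hi F"] lo_hi[of F] P_D(2)[OF F] by (metis finite_Un)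
  moreover have "card (hi F) = card (lo F)" using hi_eq[OF F] by (simp add: card_image)
  ultimately show "card (lo F) = k + 1" "card (hi F) = k + 1" using P_D(3)[OF F] by auto
qed

lemma parts_no_one:
  assumes "F \<in> P" "1 \<notin> F"
  shows "upper_part F = hi F" "lower_part F = lo F"
proof -
  have "x \<notin> ini F" for x
  proof
    assume "x \<in> ini F"
    then have x: "x \<in> F" "{1..x} \<subseteq> F" by (auto simp: ini_def)
    then have "x \<noteq> 0" using P_D(4)[OF assms(1)] by metis
    then have "1 \<in> {1..x}" by simp
    then show False using assms(2) x(2) by blast
  qed
  then show "upper_part F = hi F" "lower_part F = lo F" by (auto simp: upper_part_def lower_part_def)
qed

lemma ex_min_rk:
  assumes "X \<subseteq> P" "X \<noteq> {}"
  shows "\<exists>F\<in>X. \<forall>F'\<in>X. rk F \<le> rk F'"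
proof -
  have f: "finite X" by (rule finite_subset[OF assms(1) finite_P])
  then have "Min (rk ` X) \<in> rk ` X" using assms(2) by (intro Min_in) auto
  then obtain F where "F \<in> X" "rk F = Min (rk ` X)" by (metis imageE)
  then show ?thesis using f by (intro bexI[of _ F]) (simp_all add: Min_le)
qed

lemma ex_max_rk:
  assumes "X \<subseteq> P" "X \<noteq> {}"
  shows "\<exists>F\<in>X. \<forall>F'\<in>X. rk F' \<le> rk F"
proof -
  have f: "finite X" by (rule finite_subset[OF assms(1) finite_P])
  then have "Max (rk ` X) \<in> rk ` X" using assms(2) by (intro Max_in) auto
  then obtain F where "F \<in> X" "rk F = Max (rk ` X)" by (metis imageE)
  then show ?thesis using f by (intro bexI[of _ F]) (simp_all add: Max_ge)
qed

text \<open>A cell of least rank containing \<open>G\<close> has its upper part inside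
  \<open>G\<close>, since otherwise a lower neighbour would still contain \<open>G\<close>. Without
  the vertex 1 this part is \<open>hi F\<close>, which already has \<open>k + 1\<close>
  elements.\<close>

lemma cover_min:
  assumes "G \<subseteq> {1..N}" "card G \<le> k + 1"
  shows "\<exists>F\<in>P. G \<subseteq> F \<and> (1 \<in> F \<or> G = hi F)"
proof -
  have fin: "finite G" using assms(1) finite_subset by blast
  let ?X = "{F \<in> P. G \<subseteq> F}"
  have "\<exists>F\<in>P. G \<subseteq> F"
    using even_sets_cover[of "k + 1" G] assms Nk by (simp add: P_eq_even_sets)
  then have "?X \<noteq> {}" by blast
  then obtain F where F: "F \<in> P" "G \<subseteq> F" "\<And>F'. F' \<in> P \<Longrightarrow> G \<subseteq> F' \<Longrightarrow> rk F \<le> rk F'"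
    using ex_min_rk[of ?X] by auto
  have "upper_part F \<subseteq> G"
  proof
    fix u assume u: "u \<in> upper_part F"
    show "u \<in> G"
    proof (rule ccontr)
      assume "u \<notin> G"
      then have G: "G \<subseteq> F - {u}" using F(2) by blast
      obtain F' where F': "F' \<in> P" "F - {u} \<subseteq> F'" "rk F' < rk F"
        using lower_neighbour_rk[OF F(1) u] by blast
      then show False using F(3)[OF F'(1) order_trans[OF G F'(2)]] by simp
    qed
  qed
  then have "G = hi F" if "1 \<notin> F"
    using parts_no_one[OF F(1) that] card_hi[OF F(1)] assms(2) card_seteq[OF fin] by metis
  then show ?thesis using F by blast
qed

section \<open>Ideals ending inside a layer\<close>

definition layer :: "nat \<Rightarrow> nat set set" where
  "layer s = {F \<in> P. 1 \<notin> F \<and> \<Sum>F = s}"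

text \<open>Cells through 1 are included whatever their sum: by \<open>cover_min\<close> they
  already cover every set of at most \<open>k\<close> vertices.\<close>

definition truncation :: "nat \<Rightarrow> nat set set \<Rightarrow> nat set set" where
  "truncation s A = {F \<in> P. 1 \<in> F \<or> \<Sum>F < s} \<union> A"

lemma truncation_layer: "A \<subseteq> layer s \<Longrightarrow> F \<in> layer s \<Longrightarrow> F \<in> truncation s A \<longleftrightarrow> F \<in> A"
  by (auto simp: truncation_def layer_def)

lemma truncation_rk:
  assumes A: "A \<subseteq> layer s" and F: "F \<in> layer s" and F': "F' \<in> truncation s A"
  shows "rk F' \<le> rk F"
proof (cases "1 \<in> F'")
  case True
  have "F' \<in> P" using A F' by (auto simp: truncation_def layer_def)
  then show ?thesis using True sum_le_total[of F'] F by (simp add: rk_def layer_def)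
next
  case False
  then have "\<Sum>F' \<le> s" using A F' by (auto simp: truncation_def layer_def)
  then show ?thesis using False F by (simp add: rk_def layer_def)
qed

lemma ideal_truncation:
  assumes A: "A \<subseteq> layer s"
  shows "ideal (truncation s A)"
  unfolding ideal_def
proof (intro conjI ballI impI)
  show sub: "truncation s A \<subseteq> P" using A by (auto simp: truncation_def layer_def)
  show "first_cell \<in> truncation s A" using first_cell_P by (auto simp: truncation_def)
  fix F F' assume F: "F \<in> truncation s A" and F': "F' \<in> P" and less: "rk F' < rk F"
  show "F' \<in> truncation s A"
  proof (cases "1 \<in> F'")
    case True
    then show ?thesis using F' by (simp add: truncation_def)
  next
    case False
    have "F \<in> P" using F sub by blast
    then have "1 \<notin> F" using less False sum_le_total[of F] by (auto simp: rk_def)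
    then have "\<Sum>F' < \<Sum>F" "\<Sum>F \<le> s" using less False F A by (auto simp: rk_def truncation_def layer_def)
    then show ?thesis using F' by (auto simp: truncation_def)
  qed
qed

lemma idealD:
  assumes "ideal L"
  shows "L \<subseteq> P" "\<And>F F'. F \<in> L \<Longrightarrow> F' \<in> P \<Longrightarrow> rk F' < rk F \<Longrightarrow> F' \<in> L"
  using assms unfolding ideal_def by blast+

text \<open>Take a cell of greatest rank in \<open>L\<close> containing \<open>G\<close>. Its lower
  part includes the \<open>k + 1\<close> elements of \<open>lo F\<close>, so some \<open>u\<close>
  of it is missing from \<open>G\<close>; the upper neighbour at \<open>u\<close> contains
  \<open>G\<close> and, by maximality, is outside \<open>L\<close>.\<close>

lemma down_outside:
  assumes L: "ideal L" "\<And>F. F \<in> P \<Longrightarrow> 1 \<in> F \<Longrightarrow> F \<in> L" and G: "G \<subseteq> {1..N}" "card G \<le> k"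
  shows "G \<in> down ((P - L) \<union> W)"
proof -
  have fin: "finite G" using G(1) finite_subset by blast
  obtain F0 where F0: "F0 \<in> P" "G \<subseteq> F0" "1 \<in> F0 \<or> G = hi F0" using cover_min[of G] G by auto
  have "G \<noteq> hi F0" using card_hi[OF F0(1)] G(2) by auto
  then have "F0 \<in> L" using F0 L(2) by blast
  let ?X = "{F \<in> L. G \<subseteq> F}"
  have "?X \<subseteq> P" "?X \<noteq> {}" using idealD(1)[OF L(1)] \<open>F0 \<in> L\<close> F0(2) by auto
  then obtain F where F: "F \<in> L" "G \<subseteq> F" "\<And>F'. F' \<in> L \<Longrightarrow> G \<subseteq> F' \<Longrightarrow> rk F' \<le> rk F"
    using ex_max_rk[of ?X] by auto
  have FP: "F \<in> P" using F(1) idealD(1)[OF L(1)] by blast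
  have "\<not> lo F \<subseteq> G" using card_mono[OF fin, of "lo F"] card_lo[OF FP] G(2) by auto
  then obtain u where u: "u \<in> lower_part F" "u \<notin> G" by (auto simp: lower_part_def)
  obtain F' where F': "F - {u} \<subseteq> F'" "F' \<in> W \<or> F' \<in> P \<and> rk F < rk F'"
    using upper_neighbour_rk[OF FP u(1)] by blast
  have GF: "G \<subseteq> F'" using F(2) F'(1) u(2) by blast
  then have "F' \<in> (P - L) \<union> W" using F'(2) F(3)[of F'] by auto
  then show ?thesis by (rule downI[OF GF])
qed

lemma down_truncation:
  assumes G: "G \<subseteq> {1..N}" "card G \<le> k"
  shows "G \<in> down (truncation s A)"
proof -
  obtain F0 where F0: "F0 \<in> P" "G \<subseteq> F0" "1 \<in> F0 \<or> G = hi F0" using cover_min[of G] G by auto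
  have "G \<noteq> hi F0" using card_hi[OF F0(1)] G(2) by auto
  then have "F0 \<in> truncation s A" using F0 by (simp add: truncation_def)
  then show ?thesis by (rule downI[OF F0(2)])
qed

definition outside :: "nat set set \<Rightarrow> nat set set" where
  "outside L = (P - L) \<union> W"

text \<open>Recovers \<open>A\<close> from the hypersurface: any other cell containing
  \<open>hi F\<close> has larger rank than \<open>F\<close>, so inside the truncation only
  \<open>F\<close> itself can contribute this face.\<close>

lemma hi_in_bd_iff:
  assumes A: "A \<subseteq> layer s" and F: "F \<in> layer s"
  shows "hi F \<in> bd (truncation s A) (outside (truncation s A)) \<longleftrightarrow> F \<in> A"
proof
  have FP: "F \<in> P" "1 \<notin> F" using F by (auto simp: layer_def)
  note pt = parts_no_one[OF FP]
  {
    assume "F \<in> A"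
    have hF: "hi F \<subseteq> F" by (auto simp: hi_def)
    have "F \<in> truncation s A" using \<open>F \<in> A\<close> by (simp add: truncation_def)
    then have d: "hi F \<in> down (truncation s A)" by (rule downI[OF hF])
    have "lo F \<noteq> {}" using card_lo[OF FP(1)] by auto
    then obtain u where u: "u \<in> lower_part F" "u \<in> lo F" using pt by auto
    obtain F' where F': "F - {u} \<subseteq> F'" "F' \<in> W \<or> F' \<in> P \<and> rk F < rk F'"
      using upper_neighbour_rk[OF FP(1) u(1)] by blast
    have "hi F \<subseteq> F'" using hF F'(1) u(2) lo_hi(1)[of F] by blast
    moreover have "F' \<in> outside (truncation s A)"
      using F'(2) truncation_rk[OF A F, of F'] by (auto simp: outside_def)
    ultimately have "hi F \<in> down (outside (truncation s A))" by (rule downI)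
    with d show "hi F \<in> bd (truncation s A) (outside (truncation s A))" by (simp add: bd_def)
  }
  assume "hi F \<in> bd (truncation s A) (outside (truncation s A))"
  then obtain F' where F': "upper_part F \<subseteq> F'" "F' \<in> truncation s A" using pt by (auto simp: bd_def down_def)
  have "F' \<in> P" using F'(2) idealD(1)[OF ideal_truncation[OF A]] by blast
  then have "F' = F" using upper_part_rk[OF FP(1) _ F'(1)] truncation_rk[OF A F F'(2)] by auto
  then show "F \<in> A" using F'(2) truncation_layer[OF A F] by simp
qed

section \<open>Slabs\<close>

text \<open>The rotation of \<open>{1..N}\<close>, a symmetry of the cyclic sphere with facets
  \<open>P \<union> W\<close>.\<close>

definition sh :: "nat \<Rightarrow> nat" where "sh x = (if x = N then 1 else Suc x)"

lemma sh_inj: "inj_on sh {1..N}" and sh_in: "x \<in> {1..N} \<Longrightarrow> sh x \<in> {1..N}"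
  by (auto simp: sh_def inj_on_def split: if_splits)

lemma sh_surj: "y \<in> {1..N} \<Longrightarrow> \<exists>x\<in>{1..N}. sh x = y"
proof -
  assume y: "y \<in> {1..N}"
  show ?thesis
  proof (cases "y = 1")
    case True
    then show ?thesis using y by (intro bexI[of _ N]) (auto simp: sh_def)
  next
    case False
    then show ?thesis using y by (intro bexI[of _ "y - 1"]) (auto simp: sh_def)
  qed
qed

lemma sh_subset_iff: "X \<subseteq> {1..N} \<Longrightarrow> Y \<subseteq> {1..N} \<Longrightarrow> sh ` X \<subseteq> sh ` Y \<longleftrightarrow> X \<subseteq> Y"
  using sh_inj by (rule inj_on_image_subset_iff)

lemma card_sh: "F \<subseteq> {1..N} \<Longrightarrow> card (sh ` F) = card F"
  using inj_on_subset[OF sh_inj] by (rule card_image)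

lemma sh_image_sub: "F \<subseteq> {1..N} \<Longrightarrow> sh ` F \<subseteq> {1..N}"
  using sh_in by blast

lemma one_in_sh: "F \<subseteq> {1..N} \<Longrightarrow> 1 \<in> sh ` F \<longleftrightarrow> N \<in> F"
  by (auto simp: sh_def image_iff split: if_splits)

lemma cnt_sh:
  assumes F: "F \<subseteq> {1..N}" and t: "1 \<le> t" "t < N"
  shows "cnt (sh ` F) (Suc t) = cnt F t + (if N \<in> F then 1 else 0)"
proof -
  have fin: "finite F" using F finite_subset by blast
  have "sh ` F \<inter> {..<Suc t} = (if N \<in> F then insert 1 (Suc ` (F \<inter> {..<t})) else Suc ` (F \<inter> {..<t}))"
    using F t by (auto simp: sh_def image_iff split: if_splits)
  moreover have "1 \<notin> Suc ` (F \<inter> {..<t})" using F by auto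
  ultimately show ?thesis using fin by (simp add: cnt_def card_image)
qed

lemma W_one: "F \<in> W \<Longrightarrow> 1 \<in> F"
  using W_D(5)[of F 1] cnt_one[OF W_D(1)[of F]] Nk by auto

lemma W_last: "F \<in> W \<Longrightarrow> N \<in> F"
proof (rule ccontr)
  assume F: "F \<in> W" "N \<notin> F"
  then have "cnt F N = 2 * k + 2" using cnt_Suc[OF W_D(2)[OF F(1)], of N] cnt_all[OF W_D(1)[OF F(1)]] W_D(3)[OF F(1)] by simp
  then show False using W_D(5)[OF F(1), of N] F(2) Nk by simp
qed

lemma sh_gap:
  assumes F: "F \<subseteq> {1..N}" and t: "t \<in> {1..N}" "t \<notin> sh ` F" "t \<noteq> 1"
  obtains t' where "t = Suc t'" "1 \<le> t'" "t' < N" "t' \<notin> F" "t' \<in> {1..N}"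
proof -
  obtain t' where t': "t = Suc t'" using t by (cases t) auto
  then have "1 \<le> t'" "t' < N" using t by auto
  moreover have "t' \<notin> F"
  proof
    assume "t' \<in> F"
    then have "sh t' \<in> sh ` F" by blast
    then show False using t(2) t' \<open>t' < N\<close> by (simp add: sh_def)
  qed
  ultimately show ?thesis using that t' by auto
qed

text \<open>Counts start at vertex 1, so an element wrapping around from \<open>N\<close> raises all
  of them by one: this is the passage from \<open>P\<close> to \<open>W\<close>.\<close>

lemma sh_P:
  assumes F: "F \<in> P"
  shows "sh ` F \<in> (if N \<in> F then W else P)"
proof -
  note f = P_D[OF F]
  have "cnt (sh ` F) t mod 2 = (if N \<in> F then 1 else 0)" if t: "t \<in> {1..N} - sh ` F" for t
  proof (cases "t = 1")
    case True
    then have "N \<notin> F" using t one_in_sh[OF f(1)] by auto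
    then show ?thesis using cnt_one[OF sh_image_sub[OF f(1)]] True by simp
  next
    case False
    obtain t' where t': "t = Suc t'" "1 \<le> t'" "t' < N" "t' \<notin> F" "t' \<in> {1..N}"
      using sh_gap[OF f(1)] t False by blast
    then show ?thesis using cnt_sh[OF f(1) t'(2,3)] f(5)[OF t'(5,4)] by auto
  qed
  then show ?thesis
    using sh_image_sub[OF f(1)] card_sh[OF f(1)] f(3) by (auto simp: P_def W_def even_iff_mod_2_eq_zero)
qed

lemma sh_W:
  assumes F: "F \<in> W"
  shows "sh ` F \<in> P" "1 \<in> sh ` F"
proof -
  note f = W_D[OF F]
  show one: "1 \<in> sh ` F" using one_in_sh[OF f(1)] W_last[OF F] by blast
  have "even (cnt (sh ` F) t)" if t: "t \<in> {1..N} - sh ` F" for t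
  proof -
    have "t \<noteq> 1" using t one by auto
    then obtain t' where t': "t = Suc t'" "1 \<le> t'" "t' < N" "t' \<notin> F" "t' \<in> {1..N}"
      using sh_gap[OF f(1)] t by blast
    then show ?thesis using cnt_sh[OF f(1) t'(2,3)] f(5)[OF t'(5,4)] W_last[OF F] by simp
  qed
  then show "sh ` F \<in> P"
    using sh_image_sub[OF f(1)] card_sh[OF f(1)] f(3) by (auto simp: P_def)
qed

lemma sh_preimage:
  assumes F: "F \<in> W \<or> F \<in> P \<and> 1 \<notin> F"
  obtains z where "z \<in> P" "F = sh ` z"
proof -
  have f: "F \<subseteq> {1..N}" "card F = 2 * k + 2" using F by (auto simp: P_def W_def)
  define z where "z = {x \<in> {1..N}. sh x \<in> F}"
  have zN: "z \<subseteq> {1..N}" by (auto simp: z_def)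
  have z: "F = sh ` z"
  proof (intro set_eqI iffI)
    fix y assume "y \<in> F"
    then obtain x where "x \<in> {1..N}" "sh x = y" using sh_surj f(1) by blast
    then show "y \<in> sh ` z" using \<open>y \<in> F\<close> by (auto simp: z_def)
  qed (auto simp: z_def)
  have cz: "card z = 2 * k + 2" using card_sh[OF zN] z f(2) by simp
  have fz: "finite z" using zN finite_subset by blast
  have "even (cnt z t)" if t: "t \<in> {1..N} - z" for t
  proof (cases "t = N")
    case True
    then have "cnt z N = 2 * k + 2" using cnt_Suc[OF fz, of N] cnt_all[OF zN] cz t by simp
    with True show ?thesis by simp
  next
    case False
    then have "t \<in> {1..N}" "1 \<le> t" "t < N" "Suc t \<in> {1..N}" using t by auto
    moreover have "Suc t \<notin> F" using t False by (auto simp: z_def sh_def)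
    moreover have "N \<in> z \<longleftrightarrow> 1 \<in> F" using one_in_sh[OF zN] z by simp
    ultimately show ?thesis
      using F cnt_sh[OF zN, of t] W_D(5)[of F "Suc t"] P_D(5)[of F "Suc t"] W_one[of F] z by auto
  qed
  then have "z \<in> P" using zN cz by (simp add: P_def)
  then show ?thesis using that z by blast
qed

lemma sh_inj_P: "F \<in> P \<Longrightarrow> F' \<in> P \<Longrightarrow> sh ` F = sh ` F' \<Longrightarrow> F = F'"
  using sh_subset_iff P_D(1) by (metis subset_antisym order_refl)

text \<open>The link between the two phases: the shift of a cell \<open>F\<close> contains
  \<open>hi F\<close>, and incidences with \<open>hi F\<close> pull back to incidences with
  \<open>lo F\<close>.\<close>

lemma sh_lo: "F \<in> P \<Longrightarrow> sh ` lo F = hi F"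
proof -
  assume F: "F \<in> P"
  have "sh x = Suc x" if "x \<in> lo F" for x
  proof -
    have "Suc x \<in> F" using P_lo[OF F] that by (auto simp: lo_def)
    then have "x \<noteq> N" using P_D(1)[OF F] by auto
    then show ?thesis by (simp add: sh_def)
  qed
  then show ?thesis using hi_eq[OF F] by auto
qed

lemma lo_sub: "F \<in> P \<Longrightarrow> lo F \<subseteq> {1..N}" and hi_sub: "F \<in> P \<Longrightarrow> hi F \<subseteq> {1..N}"
  using P_D(1) by (auto simp: lo_def hi_def)

lemma sh_diff: "F \<subseteq> {1..N} \<Longrightarrow> w \<in> {1..N} \<Longrightarrow> sh ` (F - {w}) = sh ` F - {sh w}"
  using inj_on_image_set_diff[OF sh_inj, of F "{w}"] by auto

text \<open>In the second phase a cell \<open>sh ` y\<close> with \<open>y \<notin> L\<close> crosses from the outside to the inside, with the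
  ridges opposite to \<open>hi y = sh ` lo y\<close> and \<open>sh ` hi y\<close> in the two roles. All incidences are shifts of
  those of \<open>y\<close>. Afterwards the outside is so thin that a set of \<open>k + 1\<close> vertices never lies in its
  interior.\<close>

lemma shifted_not_in_ideal:
  assumes L: "ideal L" and y: "y \<in> P - L" "1 \<notin> y" and y': "y' \<in> P" "lo y \<subseteq> y'"
  shows "sh ` y' \<notin> L"
proof
  assume s: "sh ` y' \<in> L"
  then have sP: "sh ` y' \<in> P" using idealD(1)[OF L] by blast
  have "upper_part y \<subseteq> sh ` y'"
    using image_mono[OF y'(2), of sh] sh_lo[of y] parts_no_one[of y] y by simp
  then have "sh ` y' = y \<or> rk y < rk (sh ` y')" using upper_part_rk[OF _ sP] y by blast
  then show False using s y idealD(2)[OF L s, of y] by blast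
qed

lemma shifted_in_outside:
  assumes L: "ideal L" and y: "y \<in> P - L" "1 \<notin> y" and y': "y' \<in> P" "lo y \<subseteq> y'"
  shows "sh ` y' \<in> outside L"
  using shifted_not_in_ideal[OF assms] sh_P[OF y'(1)] by (auto simp: outside_def split: if_splits)

lemma outside_shifted:
  assumes L: "\<And>F. F \<in> P \<Longrightarrow> 1 \<in> F \<Longrightarrow> F \<in> L" and F: "F \<in> outside L"
  obtains z where "z \<in> P" "F = sh ` z"
proof -
  have "F \<in> W \<or> F \<in> P \<and> 1 \<notin> F" using F L by (auto simp: outside_def)
  then show ?thesis using sh_preimage that by metis
qed

lemma shifted_lower_neighbour:
  assumes L: "ideal L" and y: "y \<in> P - L" "1 \<notin> y" and w: "w \<in> hi y"
  shows "\<exists>y'\<in>P. sh ` y - {sh w} \<subseteq> sh ` y' \<and> rk y' < rk y \<and> sh ` y' \<in> outside L"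
proof -
  have yP: "y \<in> P" using y by blast
  obtain y' where y': "y' \<in> P" "y - {w} \<subseteq> y'" "rk y' < rk y"
    using lower_neighbour_rk[OF yP, of w] w parts_no_one[OF yP y(2)] by auto
  have wN: "w \<in> {1..N}" using w hi_sub[OF yP] by blast
  have "lo y \<subseteq> y - {w}" using w by (auto simp: lo_def hi_def)
  then have "sh ` y' \<in> outside L" using shifted_in_outside[OF L y y'(1)] y'(2) by blast
  moreover have "sh ` y - {sh w} \<subseteq> sh ` y'"
    using image_mono[OF y'(2), of sh] sh_diff[OF P_D(1)[OF yP] wN] by simp
  ultimately show ?thesis using y' by blast
qed

text \<open>The shifted cells cross in order of decreasing rank of \<open>y\<close>; the induction
  strips off the least one, which crosses last. Undoing the shift reduces incidences to known ones:
  \<open>hi y\<close> inside the shift of \<open>z\<close> means \<open>lo y \<subseteq> z\<close>,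
  and the shift of \<open>hi y\<close> inside it means \<open>hi y \<subseteq> z\<close>.\<close>

lemma spheres_shift:
  assumes L: "ideal L" "\<And>F. F \<in> P \<Longrightarrow> 1 \<in> F \<Longrightarrow> F \<in> L" and v: "v \<notin> {1..N}"
    and Q: "Q \<subseteq> P - L" "\<And>y z. y \<in> Q \<Longrightarrow> z \<in> P - L \<Longrightarrow> rk y < rk z \<Longrightarrow> z \<in> Q"
  shows "spheres (2 * k) v (L \<union> (`) sh ` Q) (outside L - (`) sh ` Q)"
  using Q
proof (induction "card Q" arbitrary: Q rule: less_induct)
  case less
  note up = less.prems(2)
  show ?case
  proof (cases "Q = {}")
    case True
    then show ?thesis using spheres_ideal[OF L(1) v] by (simp add: outside_def)
  next
    case False
    have QP: "Q \<subseteq> P" using less.prems(1) by blast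
    have fQ: "finite Q" by (rule finite_subset[OF QP finite_P])
    obtain y where y: "y \<in> Q" "\<And>z. z \<in> Q \<Longrightarrow> rk y \<le> rk z" using ex_min_rk[OF QP False] by blast
    have yQ: "y \<in> P - L" and yP: "y \<in> P" using y(1) less.prems(1) by auto
    have y1: "1 \<notin> y" using L(2) yQ by blast
    note yN = P_D(1)[OF yP] and pt = parts_no_one[OF yP y1]
    note loN = lo_sub[OF yP] and hiN = hi_sub[OF yP]
    have hs: "hi y = sh ` lo y" using sh_lo[OF yP] by simp
    let ?Q = "Q - {y}"
    let ?L = "L \<union> (`) sh ` ?Q" and ?U = "outside L - (`) sh ` Q"
    have split: "sh ` hi y \<union> hi y = sh ` y"
      using hs lo_hi(2)[of y] by (metis image_Un sup_commute)
    have disj: "sh ` hi y \<inter> hi y = {}"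
      unfolding hs using lo_hi(1)[of y] inj_on_image_Int[OF sh_inj loN hiN] hs by auto
    have shQ: "z \<in> Q" if "sh ` z \<in> (`) sh ` Q" "z \<in> P" for z
    proof -
      obtain z' where "z' \<in> Q" "sh ` z = sh ` z'" using \<open>sh ` z \<in> (`) sh ` Q\<close> by blast
      then show ?thesis using sh_inj_P[OF \<open>z \<in> P\<close>, of z'] QP by auto
    qed
    have m: "cell_move (sh ` hi y) (hi y) ?L ?U"
      unfolding cell_move_def split
    proof (intro conjI ballI)
      show "finite (sh ` hi y)" "finite (hi y)" using finite_subset[OF hiN] by auto
      show "sh ` hi y \<noteq> {}" "hi y \<noteq> {}" using card_hi[OF yP] by auto
      show "sh ` hi y \<inter> hi y = {}" by (rule disj)
      show "hi y \<notin> down ?L"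
      proof
        assume "hi y \<in> down ?L"
        then obtain F where F: "hi y \<subseteq> F" "F \<in> L \<or> (\<exists>z\<in>?Q. F = sh ` z)" by (auto simp: down_def)
        from F(2) show False
        proof
          assume FL: "F \<in> L"
          then have "F = y \<or> rk y < rk F"
            using upper_part_rk[OF yP, of F] idealD(1)[OF L(1)] F(1) pt by auto
          then show False using FL yQ idealD(2)[OF L(1) FL yP] by blast
        next
          assume "\<exists>z\<in>?Q. F = sh ` z"
          then obtain z where z: "z \<in> Q" "z \<noteq> y" "F = sh ` z" by blast
          have zP: "z \<in> P" using z(1) QP by blast
          have "lo y \<subseteq> z" using F(1) sh_subset_iff[OF loN P_D(1)[OF zP]] by (simp add: hs z(3))
          then have "rk z < rk y" using lower_part_rk[OF yP zP] pt z(2) by auto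
          then show False using y(2)[OF z(1)] by simp
        qed
      qed
      show "sh ` y - {u} \<in> down ?L" if u: "u \<in> hi y" for u
      proof -
        obtain w where w: "w \<in> lo y" "u = sh w" using u unfolding hs by (rule imageE)
        then obtain y' where y': "y - {w} \<subseteq> y'" "y' \<in> W \<or> y' \<in> P \<and> rk y < rk y'"
          using upper_neighbour_rk[OF yP, of w] pt by auto
        have wN: "w \<in> {1..N}" using w(1) loN by blast
        have sub: "sh ` y - {u} \<subseteq> sh ` y'"
          using image_mono[OF y'(1), of sh] sh_diff[OF yN wN] w(2) by simp
        have "sh ` y' \<in> ?L"
          using y'(2)
        proof
          \<comment> \<open>Rotation sends a cell of \<open>W\<close> to a cell of \<open>P\<close>
            through 1, which is in \<open>L\<close> by assumption.\<close>
          assume "y' \<in> W"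
          then show ?thesis using sh_W L(2) by simp
        next
          assume a: "y' \<in> P \<and> rk y < rk y'"
          then have "y' \<notin> L" using idealD(2)[OF L(1), of y' y] yQ by blast
          then have "y' \<in> ?Q" using up[OF y(1), of y'] a by auto
          then show ?thesis by blast
        qed
        then show ?thesis by (rule downI[OF sub])
      qed
      show "sh ` hi y \<notin> down ?U"
      proof
        assume "sh ` hi y \<in> down ?U"
        then obtain F where F: "sh ` hi y \<subseteq> F" "F \<in> outside L" "F \<notin> (`) sh ` Q" by (auto simp: down_def)
        obtain z where z: "z \<in> P" "F = sh ` z" using outside_shifted[OF L(2) F(2)] by blast
        have "hi y \<subseteq> z" using F(1) sh_subset_iff[OF hiN P_D(1)[OF z(1)]] by (simp add: z(2))
        then have "z = y \<or> rk y < rk z" using upper_part_rk[OF yP z(1)] pt by simp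
        moreover have "z \<notin> Q" using F(3) z(2) by blast
        ultimately have "rk y < rk z" "z \<in> L" using y(1) up[OF y(1), of z] z(1) by auto
        then show False using idealD(2)[OF L(1), of z y] yQ by blast
      qed
      show "sh ` y - {u} \<in> down ?U" if u: "u \<in> sh ` hi y" for u
      proof -
        obtain w where w: "w \<in> hi y" "u = sh w" using u by (rule imageE)
        obtain y' where y': "y' \<in> P" "sh ` y - {u} \<subseteq> sh ` y'" "rk y' < rk y" "sh ` y' \<in> outside L"
          using shifted_lower_neighbour[OF L(1) yQ y1 w(1)] w(2) by blast
        have "sh ` y' \<notin> (`) sh ` Q" using shQ[OF _ y'(1)] y(2)[of y'] y'(3) by auto
        then have "sh ` y' \<in> ?U" using y'(4) by blast
        then show ?thesis by (rule downI[OF y'(2)])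
      qed
    qed
    have "spheres (2 * k) v ?L (outside L - (`) sh ` ?Q)"
    proof (rule less.hyps)
      show "card ?Q < card Q" by (rule card_Diff1_less[OF fQ y(1)])
      show "?Q \<subseteq> P - L" using less.prems(1) by blast
      show "z \<in> ?Q" if "x \<in> ?Q" "z \<in> P - L" "rk x < rk z" for x z
        using up[of x z] y(2)[of x] that by auto
    qed
    moreover have "outside L - (`) sh ` ?Q = insert (sh ` y) ?U"
    proof -
      have "sh ` y \<in> outside L" using shifted_in_outside[OF L(1) yQ y1 yP] by (auto simp: lo_def)
      moreover have "sh ` y \<notin> (`) sh ` ?Q"
      proof
        assume "sh ` y \<in> (`) sh ` ?Q"
        then obtain z where "z \<in> Q" "z \<noteq> y" "sh ` y = sh ` z" by blast
        then show False using sh_inj_P[OF yP, of z] QP by auto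
      qed
      ultimately show ?thesis by blast
    qed
    ultimately have s: "spheres (2 * k) v ?L (insert (sh ` y) ?U)" by simp
    have "v \<notin> sh ` y" using v sh_image_sub[OF yN] by blast
    from spheres_move[OF m, unfolded split, OF this s]
    have "spheres (2 * k) v (insert (sh ` y) ?L) ?U" .
    moreover have "insert (sh ` y) ?L = L \<union> (`) sh ` Q" using y(1) by blast
    ultimately show ?thesis by simp
  qed
qed

section \<open>The slab and its complement\<close>

definition thick_part :: "nat \<Rightarrow> nat set set \<Rightarrow> nat set set" where
  "thick_part s A = truncation s A \<union> (`) sh ` (P - truncation s A)"

definition slab :: "nat \<Rightarrow> nat set set \<Rightarrow> nat set set" where
  "slab s A = outside (truncation s A) - (`) sh ` (P - truncation s A)"

lemma truncation_one: "F \<in> P \<Longrightarrow> 1 \<in> F \<Longrightarrow> F \<in> truncation s A"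
  by (simp add: truncation_def)

text \<open>By \<open>cover_min\<close> a set not covered by the truncation equals
  \<open>hi F\<close> for a cell \<open>F\<close> outside it, and the shift of that \<open>F\<close>
  covers it.\<close>

lemma down_thick_part:
  assumes "G \<subseteq> {1..N}" "card G \<le> k + 1"
  shows "G \<in> down (thick_part s A)"
proof -
  obtain F where F: "F \<in> P" "G \<subseteq> F" "1 \<in> F \<or> G = hi F" using cover_min[OF assms] by blast
  show ?thesis
  proof (cases "F \<in> truncation s A")
    case True
    then have "F \<in> thick_part s A" by (simp add: thick_part_def)
    then show ?thesis by (rule downI[OF F(2)])
  next
    case False
    then have "G = sh ` lo F" using F truncation_one sh_lo by blast
    then have "G \<subseteq> sh ` F" by (auto simp: lo_def)
    moreover have "sh ` F \<in> thick_part s A" using F(1) False by (auto simp: thick_part_def)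
    ultimately show ?thesis by (rule downI)
  qed
qed

text \<open>Among the outside cells containing \<open>G\<close>, written as shifts of cells
  \<open>z\<close>, take one with \<open>z\<close> of least rank. If \<open>z\<close> were outside
  the truncation, the shift of \<open>hi z\<close> would have more elements than \<open>G\<close>;
  dropping one missing from \<open>G\<close> would lead to a shifted neighbour of smaller
  rank.\<close>

lemma down_slab:
  assumes A: "A \<subseteq> layer s" and G: "G \<subseteq> {1..N}" "card G \<le> k"
  shows "G \<in> down (slab s A)"
proof -
  let ?L = "truncation s A"
  note L = ideal_truncation[OF A]
  have fin: "finite G" using G(1) finite_subset by blast
  have "G \<in> down (outside ?L)"
    unfolding outside_def by (rule down_outside[OF L truncation_one G])
  then obtain F where F: "G \<subseteq> F" "F \<in> outside ?L" by (auto simp: down_def)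
  let ?X = "{z \<in> P. G \<subseteq> sh ` z \<and> sh ` z \<in> outside ?L}"
  obtain z where "z \<in> P" "F = sh ` z" using outside_shifted[OF truncation_one F(2)] by blast
  then have "z \<in> ?X" using F by blast
  then obtain z where z: "z \<in> P" "G \<subseteq> sh ` z" "sh ` z \<in> outside ?L"
    and min: "\<And>z'. z' \<in> ?X \<Longrightarrow> rk z \<le> rk z'"
    using ex_min_rk[of ?X] by blast
  have "z \<in> ?L"
  proof (rule ccontr)
    assume "z \<notin> ?L"
    then have zQ: "z \<in> P - ?L" "1 \<notin> z" using z(1) truncation_one by blast+
    have "card (sh ` hi z) = k + 1" using card_sh[OF hi_sub[OF z(1)]] card_hi[OF z(1)] by simp
    then have "\<not> sh ` hi z \<subseteq> G" using card_mono[OF fin, of "sh ` hi z"] G(2) by auto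
    then obtain w where w: "w \<in> hi z" "sh w \<notin> G" by blast
    obtain y where y: "y \<in> P" "sh ` z - {sh w} \<subseteq> sh ` y" "rk y < rk z" "sh ` y \<in> outside ?L"
      using shifted_lower_neighbour[OF L zQ w(1)] by blast
    have "G \<subseteq> sh ` z - {sh w}" using z(2) w(2) by (simp add: subset_Diff_insert)
    then have "G \<subseteq> sh ` y" using y(2) by (rule order_trans)
    then have "rk z \<le> rk y" using min[of y] y(1,4) by simp
    then show False using y(3) by simp
  qed
  have "sh ` z \<notin> (`) sh ` (P - ?L)"
  proof
    assume "sh ` z \<in> (`) sh ` (P - ?L)"
    then obtain z' where z': "z' \<in> P - ?L" "sh ` z = sh ` z'" by (elim imageE)
    then have "z = z'" using sh_inj_P[OF z(1), of z'] by simp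
    then show False using z'(1) \<open>z \<in> ?L\<close> by simp
  qed
  then have "sh ` z \<in> slab s A" using z(3) by (simp add: slab_def)
  then show ?thesis by (rule downI[OF z(2)])
qed

lemma cells_sub:
  assumes "F \<in> P \<union> (`) sh ` P"
  shows "F \<subseteq> {1..N} \<and> card F = 2 * k + 2"
proof -
  consider "F \<in> P" | z where "z \<in> P" "F = sh ` z" using assms by auto
  then show ?thesis
  proof cases
    case (2 z)
    then show ?thesis using sh_image_sub[OF P_D(1)] card_sh[OF P_D(1)] P_D(3) by simp
  qed (use P_D(1,3) in blast)
qed

lemma truncation_sub: "A \<subseteq> layer s \<Longrightarrow> truncation s A \<subseteq> P"
  by (auto simp: truncation_def layer_def)

lemma thick_part_cells: "A \<subseteq> layer s \<Longrightarrow> F \<in> thick_part s A \<Longrightarrow> F \<subseteq> {1..N} \<and> card F = 2 * k + 2"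
  using truncation_sub[of A s] by (intro cells_sub) (auto simp: thick_part_def)

text \<open>In even dimension every \<open>hi F\<close> is a face, so \<open>A\<close> is read off
  from the cells themselves. A cell of the layer is no shift of a cell \<open>z\<close> outside the
  truncation: without wrapping around, the shift adds \<open>2 * k + 2\<close> to the sum, so
  \<open>z\<close> would have sum below \<open>s\<close>.\<close>

lemma layer_in_thick_part:
  assumes A: "A \<subseteq> layer s" and F: "F \<in> layer s"
  shows "F \<in> down (thick_part s A) \<longleftrightarrow> F \<in> A"
proof
  assume "F \<in> A"
  then have "F \<in> thick_part s A" by (simp add: thick_part_def truncation_def)
  then show "F \<in> down (thick_part s A)" by (intro downI[OF order_refl])
next
  have FP: "F \<in> P" "1 \<notin> F" "\<Sum>F = s" using F by (auto simp: layer_def)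
  assume "F \<in> down (thick_part s A)"
  then obtain F' where F': "F \<subseteq> F'" "F' \<in> thick_part s A" by (auto simp: down_def)
  have "finite F'" "card F = card F'"
    using thick_part_cells[OF A F'(2)] P_D(3)[OF FP(1)] finite_subset[of F'] by auto
  then have "F = F'" using card_subset_eq F'(1) by blast
  then consider "F \<in> truncation s A" | z where "z \<in> P - truncation s A" "F = sh ` z" using F'(2) by (auto simp: thick_part_def)
  then show "F \<in> A"
  proof cases
    case 1
    then show ?thesis using truncation_layer[OF A F] by simp
  next
    case 2
    have zP: "z \<in> P" using 2 by blast
    have zN: "N \<notin> z" using one_in_sh[OF P_D(1)[OF zP]] FP(2) 2(2) by simp
    have "\<Sum>F = (\<Sum>x\<in>z. sh x)" unfolding 2(2)
      by (subst sum.reindex) (use inj_on_subset[OF sh_inj P_D(1)[OF zP]] in simp_all)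
    also have "\<dots> = (\<Sum>x\<in>z. Suc x)" using zN by (intro sum.cong) (auto simp: sh_def)
    also have "\<dots> = \<Sum>z + card z" by (simp add: sum.distrib Suc_eq_plus1 del: Suc_eq_plus1[symmetric] One_nat_def)
    finally have "\<Sum>z < s" using P_D(3)[OF zP] FP(3) by simp
    then show ?thesis using 2 zP by (auto simp: truncation_def)
  qed
qed

section \<open>The neighborly spheres for both parities\<close>

lemma odd_sphere:
  assumes A: "A \<subseteq> layer s"
  defines "K \<equiv> bd (truncation s A) (outside (truncation s A))"
  assumes k: "1 \<le> k"
  shows "simplicial_sphere (2 * k + 1) {1..N} K" "neighborly k {1..N} K"
proof -
  note L = ideal_truncation[OF A]
  have nb: "S \<in> K" if "S \<subseteq> {1..N}" "card S \<le> k" for S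
    using down_truncation[OF that] down_outside[OF L truncation_one that] by (simp add: K_def bd_def outside_def)
  then show "neighborly k {1..N} K" by (simp add: neighborly_def)
  have "simplicial_complex_on {1..N} K"
    unfolding simplicial_complex_on_def
  proof (intro conjI ballI allI impI)
    fix F assume F: "F \<in> K"
    then obtain F' where F': "F' \<in> truncation s A" "F \<subseteq> F'" by (auto simp: K_def bd_def down_def)
    then show "F \<subseteq> {1..N}" using truncation_sub[OF A] P_D(1)[of F'] by blast
    then show "finite F" using finite_subset by blast
    fix G assume "G \<subseteq> F"
    then show "G \<in> K" using F down_mono unfolding K_def bd_def by blast
  qed (use nb k in auto)
  moreover have "N + 1 \<notin> {1..N}" by simp
  from spheres_ideal[OF L this] have
    "subtopology (powertop_real UNIV) (geom_realization K) homeomorphic_space nsphere (2 * k)"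
    by (simp add: spheres_def K_def outside_def)
  ultimately show "simplicial_sphere (2 * k + 1) {1..N} K" by (simp add: simplicial_sphere_def)
qed

text \<open>A set through the apex needs its remaining, at most \<open>k\<close>, vertices to be a
  face of both regions; a set avoiding the apex needs only the thick part, which covers all sets of
  size \<open>k + 1\<close>.\<close>

lemma even_sphere:
  assumes A: "A \<subseteq> layer s"
  defines "K \<equiv> cone (N + 1) (slab s A) (thick_part s A)"
  shows "simplicial_sphere (2 * k + 2) {1..N + 1} K" "neighborly (k + 1) {1..N + 1} K"
proof -
  note L = ideal_truncation[OF A]
  have nb: "S \<in> K" if S: "S \<subseteq> {1..N + 1}" "card S \<le> k + 1" for S
  proof (cases "N + 1 \<in> S")
    case True
    have fS: "finite S" using S(1) finite_subset by blast
    have G: "S - {N + 1} \<subseteq> {1..N}" using S(1) by auto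
    have "card (S - {N + 1}) \<le> k" using True S(2) fS by simp
    then show ?thesis using True down_slab[OF A G] down_thick_part[OF G] by (simp add: K_def cone_def bd_def)
  next
    case False
    have "x \<in> {1..N}" if "x \<in> S" for x
      using False S(1) that by (cases "x = N + 1") auto
    then have "S \<subseteq> {1..N}" by blast
    then show ?thesis using False down_thick_part S(2) by (simp add: K_def cone_def)
  qed
  then show "neighborly (k + 1) {1..N + 1} K" by (simp add: neighborly_def)
  have dn: "G \<subseteq> {1..N}" if "G \<in> down (thick_part s A)" for G
    using that thick_part_cells[OF A] unfolding down_def by blast
  have "simplicial_complex_on {1..N + 1} K"
    unfolding simplicial_complex_on_def
  proof (intro conjI ballI allI impI)
    fix F assume F: "F \<in> K"
    then have d: "F - {N + 1} \<in> down (thick_part s A)"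
      by (cases "N + 1 \<in> F") (auto simp: K_def cone_def bd_def)
    then show FN: "F \<subseteq> {1..N + 1}" using dn[OF d] by auto
    then show "finite F" using finite_subset by blast
    fix G assume GF: "G \<subseteq> F"
    have GF': "G - {N + 1} \<subseteq> F - {N + 1}" using GF by blast
    have g: "G - {N + 1} \<in> down (thick_part s A)" by (rule down_mono[OF d GF'])
    show "G \<in> K"
    proof (cases "N + 1 \<in> G")
      case True
      then have "F - {N + 1} \<in> down (slab s A)" using F GF by (auto simp: K_def cone_def bd_def)
      then have "G - {N + 1} \<in> down (slab s A)" using GF' by (rule down_mono)
      then show ?thesis using True g by (simp add: K_def cone_def bd_def)
    next
      case False
      then show ?thesis using g by (simp add: K_def cone_def)
    qed
  qed (use nb in auto)
  moreover have "N + 1 \<notin> {1..N}" by simp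
  from spheres_shift[OF L truncation_one this order_refl] have
    "subtopology (powertop_real UNIV) (geom_realization K) homeomorphic_space nsphere (2 * k + 1)"
    by (simp add: spheres_def K_def thick_part_def slab_def)
  ultimately show "simplicial_sphere (2 * k + 2) {1..N + 1} K" by (simp add: simplicial_sphere_def)
qed

lemma finite_layer: "finite (layer s)"
  by (rule finite_subset[OF _ finite_P]) (auto simp: layer_def)

lemma sn_odd:
  assumes "1 \<le> k"
  shows "2 ^ card (layer s) \<le> sn (2 * k + 1) N"
proof -
  let ?f = "\<lambda>A. bd (truncation s A) (outside (truncation s A))"
  have "inj_on ?f (Pow (layer s))"
  proof (rule inj_onI)
    fix A B assume "A \<in> Pow (layer s)" "B \<in> Pow (layer s)" "?f A = ?f B"
    then have AB: "A \<subseteq> layer s" "B \<subseteq> layer s" "?f A = ?f B" by auto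
    have "F \<in> A \<longleftrightarrow> F \<in> B" if "F \<in> layer s" for F
      using hi_in_bd_iff[OF AB(1) that] hi_in_bd_iff[OF AB(2) that] AB(3) by simp
    then show "A = B" using AB(1,2) by blast
  qed
  then have "card (Pow (layer s)) \<le> sn (2 * k + 1) N"
    by (rule sn_ge_card) (use odd_sphere assms in simp)
  then show ?thesis by (simp add: card_Pow finite_layer)
qed

lemma sn_even: "2 ^ card (layer s) \<le> sn (2 * k + 2) (N + 1)"
proof -
  let ?f = "\<lambda>A. cone (N + 1) (slab s A) (thick_part s A)"
  have "inj_on ?f (Pow (layer s))"
  proof (rule inj_onI)
    fix A B assume "A \<in> Pow (layer s)" "B \<in> Pow (layer s)" "?f A = ?f B"
    then have AB: "A \<subseteq> layer s" "B \<subseteq> layer s" "?f A = ?f B" by auto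
    have "F \<in> A \<longleftrightarrow> F \<in> B" if F: "F \<in> layer s" for F
    proof -
      have "F \<subseteq> {1..N}" using F P_D(1) by (auto simp: layer_def)
      then have "N + 1 \<notin> F" by auto
      then have C: "F \<in> ?f C \<longleftrightarrow> F \<in> down (thick_part s C)" for C by (simp add: cone_def)
      show ?thesis
        using C[of A] C[of B] layer_in_thick_part[OF AB(1) F] layer_in_thick_part[OF AB(2) F] AB(3)
        by (simp only:)
    qed
    then show "A = B" using AB(1,2) by blast
  qed
  then have "card (Pow (layer s)) \<le> sn (2 * k + 2) (N + 1)"
    by (rule sn_ge_card) (use even_sphere in simp)
  then show ?thesis by (simp add: card_Pow finite_layer)
qed

section \<open>Large layers\<close>

text \<open>The aligned pairs \<open>{2 * t, 2 * t + 1}\<close> never overlap, so any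
  \<open>k + 1\<close> indices in range give a cell, and these cells suffice for the order of
  growth. Starting at \<open>t = 1\<close> avoids the vertex 1.\<close>

definition pairs :: "nat set \<Rightarrow> nat set" where
  "pairs T = (*) 2 ` T \<union> (\<lambda>t. 2 * t + 1) ` T"

lemma card_pairs: "finite T \<Longrightarrow> card (pairs T) = 2 * card T"
proof -
  assume T: "finite T"
  have "(*) 2 ` T \<inter> (\<lambda>t. 2 * t + 1) ` T = {}" by auto presburger
  then have "card (pairs T) = card ((*) 2 ` T) + card ((\<lambda>t. 2 * t + 1) ` T)"
    unfolding pairs_def using T by (intro card_Un_disjoint) auto
  then show ?thesis by (simp add: card_image inj_on_def)
qed

lemma pairs_P:
  assumes T: "T \<subseteq> {1..(N - 1) div 2}" "card T = k + 1"
  shows "pairs T \<in> P" "1 \<notin> pairs T"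
proof -
  have fin: "finite T" using T(1) finite_subset by blast
  have "even (cnt (pairs T) t)" if t: "t \<notin> pairs T" for t
  proof -
    define w where "w = t div 2"
    have tw: "t = 2 * w \<or> t = 2 * w + 1" unfolding w_def by presburger
    then have "w \<notin> T" using t by (auto simp: pairs_def)
    then have "t' \<noteq> w" if "t' \<in> T" for t' using that by blast
    then have "pairs T \<inter> {..<t} = pairs (T \<inter> {..<w})"
      using tw by (fastforce simp: pairs_def)
    then show ?thesis using card_pairs[of "T \<inter> {..<w}"] fin by (simp add: cnt_def)
  qed
  moreover have "pairs T \<subseteq> {1..N}"
  proof
    fix x assume "x \<in> pairs T"
    then obtain t where t: "t \<in> T" "x = 2 * t \<or> x = 2 * t + 1" by (auto simp: pairs_def)
    then have "1 \<le> t" "t \<le> (N - 1) div 2" using T(1) by auto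
    then have "1 \<le> t" "2 * t + 1 \<le> N" using Nk by linarith+
    then show "x \<in> {1..N}" using t(2) by auto
  qed
  ultimately show "pairs T \<in> P" using card_pairs[OF fin] T(2) by (simp add: P_def)
  show "1 \<notin> pairs T" using T(1) by (auto simp: pairs_def)
qed

text \<open>Pigeonhole over the sums: \<open>2 * k + 2\<close> elements of size at most
  \<open>N\<close> leave \<open>(2 * k + 2) * N + 1\<close> possible values.\<close>

lemma large_layer:
  "\<exists>s. ((N - 1) div 2) choose (k + 1) \<le> ((2 * k + 2) * N + 1) * card (layer s)"
proof -
  let ?q = "(N - 1) div 2" and ?M = "(2 * k + 2) * N"
  define X where "X = {T. T \<subseteq> {1..?q} \<and> card T = k + 1}"
  have inj: "inj_on pairs X"
  proof (rule inj_onI)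
    fix S T assume "pairs S = pairs T"
    moreover have "2 * x \<in> pairs R \<longleftrightarrow> x \<in> R" for x R
      unfolding pairs_def by auto presburger
    ultimately show "S = T" by blast
  qed
  have "pairs ` X \<subseteq> (\<Union>s\<in>{..?M}. layer s)"
  proof
    fix F assume "F \<in> pairs ` X"
    then have F: "F \<in> P" "1 \<notin> F" using pairs_P by (auto simp: X_def)
    have "\<Sum>F \<le> card F * N"
      using sum_bounded_above[of F "\<lambda>x. x" N] P_D(1)[OF F(1)] by force
    then have "\<Sum>F \<le> ?M" using P_D(3)[OF F(1)] by simp
    then show "F \<in> (\<Union>s\<in>{..?M}. layer s)" using F by (auto simp: layer_def)
  qed
  then have "card (pairs ` X) \<le> card (\<Union>s\<in>{..?M}. layer s)"
    by (intro card_mono) (auto simp: finite_layer)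
  also have "\<dots> \<le> (\<Sum>s\<le>?M. card (layer s))" by (rule card_UN_le) simp
  finally have le: "card X \<le> (\<Sum>s\<le>?M. card (layer s))" using inj by (simp add: card_image)
  let ?c = "(\<lambda>s. card (layer s)) ` {..?M}"
  have "Max ?c \<in> ?c" by (intro Max_in) auto
  then obtain s where s: "card (layer s) = Max ?c" by (metis imageE)
  have "card (layer t) \<le> card (layer s)" if "t \<in> {..?M}" for t
    unfolding s using that by (intro Max_ge) auto
  then have "(\<Sum>s\<le>?M. card (layer s)) \<le> card {..?M} * card (layer s)"
    using sum_bounded_above[of "{..?M}" "\<lambda>s. card (layer s)" "card (layer s)"] by simp
  moreover have "card X = ?q choose (k + 1)" unfolding X_def using n_subsets[of "{1..?q}" "k + 1"] by simp
  ultimately show ?thesis using le by (intro exI[of _ s]) simp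
qed

end

text \<open>The quotient of two bounds: at least \<open>(n / (4 * (k + 1))) ^ (k + 1)\<close>
  aligned cells, and at most \<open>(2 * k + 3) * n\<close> sums; one factor \<open>n\<close>
  cancels.\<close>

definition growth :: "nat \<Rightarrow> real" where
  "growth k = 1 / ((4 * (real k + 1)) ^ (k + 1) * (2 * real k + 3))"

lemma growth_pos: "growth k > 0"
  by (simp add: growth_def)

lemma large_layer_real:
  assumes n: "4 * k + 8 \<le> n" and N: "N \<le> n" "n \<le> N + 1"
  shows "\<exists>s. growth k * real n ^ k \<le> real (card (cyclic_cells.layer N k s))"
proof -
  interpret cyclic_cells N k by unfold_locales (use n N in linarith)
  let ?q = "(N - 1) div 2"
  obtain s where s: "?q choose (k + 1) \<le> ((2 * k + 2) * N + 1) * card (layer s)"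
    using large_layer by blast
  \<comment> \<open>The factor 4 pays for the halving, the rounding and the vertex that may be
    reserved for the apex.\<close>
  have q: "n \<le> 4 * ?q" "k + 1 \<le> ?q" using n N by presburger+
  have "real n \<le> real (4 * ?q)" using q(1) by (rule of_nat_mono)
  then have "real n / (4 * (real k + 1)) \<le> real (4 * ?q) / (4 * (real k + 1))"
    by (intro divide_right_mono) auto
  also have "\<dots> = (4 * real ?q) / (4 * (real k + 1))" by simp
  also have "\<dots> = real ?q / (real k + 1)" by (rule mult_divide_mult_cancel_left) simp
  finally have "(real n / (4 * (real k + 1))) ^ (k + 1) \<le> (real ?q / (real k + 1)) ^ (k + 1)"
    by (rule power_mono) simp
  also have "\<dots> = (real ?q / real (k + 1)) ^ (k + 1)" by (simp add: add.commute)
  also have "\<dots> \<le> real (?q choose (k + 1))"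
    using binomial_ge_n_over_k_pow_k[OF q(2), where 'a = real] by simp
  also have "\<dots> \<le> real (((2 * k + 2) * N + 1) * card (layer s))" using s by (rule of_nat_mono)
  also have "\<dots> = real ((2 * k + 2) * N + 1) * real (card (layer s))" by (rule of_nat_mult)
  also have "\<dots> \<le> ((2 * real k + 3) * real n) * real (card (layer s))"
  proof (rule mult_right_mono)
    have "(2 * k + 2) * N + 1 \<le> (2 * k + 2) * n + n" using N n by (intro add_mono mult_left_mono) auto
    then have "real ((2 * k + 2) * N + 1) \<le> real ((2 * k + 2) * n + n)" by (rule of_nat_mono)
    then show "real ((2 * k + 2) * N + 1) \<le> (2 * real k + 3) * real n" by (simp add: algebra_simps)
  qed simp
  finally have a: "(real n / (4 * (real k + 1))) ^ (k + 1) \<le> ((2 * real k + 3) * real n) * real (card (layer s))" .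
  have np: "real n > 0" and kp: "2 * real k + 3 > 0" using n by auto
  have "growth k * real n ^ k = (real n / (4 * (real k + 1))) ^ (k + 1) / ((2 * real k + 3) * real n)"
    using np by (simp add: growth_def power_divide)
  also have "\<dots> \<le> real (card (layer s))"
    using a np kp by (subst pos_divide_le_eq) (simp_all add: mult.commute)
  finally show ?thesis by blast
qed

theorem theorem1p2:
  fixes d :: nat
  assumes "d \<ge> 5"
  shows "\<exists>c::real. c > 0 \<and> (\<exists>n0::nat. \<forall>n\<ge>n0.
           real (sn d n) \<ge> 2 powr (c * real n ^ ((d - 1) div 2)))"
proof -
  define k where "k = (d - 1) div 2"
  have k: "1 \<le> k" "d = 2 * k + 1 \<or> d = 2 * k + 2" using assms unfolding k_def by presburger+
  have "2 powr (growth k * real n ^ k) \<le> real (sn d n)" if n: "4 * k + 8 \<le> n" for n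
  proof -
    \<comment> \<open>For even \<open>d\<close> the vertex \<open>n\<close> is the apex
      \<open>N + 1\<close>, and the cyclic sphere lives on the other \<open>n - 1\<close>
      vertices.\<close>
    define N where "N = (if d = 2 * k + 1 then n else n - 1)"
    have N: "N \<le> n" "n \<le> N + 1" "2 * k + 4 \<le> N" using n by (auto simp: N_def)
    interpret cyclic_cells N k by unfold_locales (rule N(3))
    obtain s where s: "growth k * real n ^ k \<le> real (card (layer s))"
      using large_layer_real[OF n N(1,2)] by blast
    have "2 ^ card (layer s) \<le> sn d n"
    proof (cases "d = 2 * k + 1")
      case True
      then show ?thesis using sn_odd[OF k(1), of s] by (simp add: N_def)
    next
      case False
      then have "d = 2 * k + 2" "N + 1 = n" using k(2) n by (auto simp: N_def)
      then show ?thesis using sn_even[of s] by simp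
    qed
    then have le: "real (2 ^ card (layer s)) \<le> real (sn d n)" by (rule of_nat_mono)
    have "2 powr (growth k * real n ^ k) \<le> 2 powr real (card (layer s))"
      using s by (intro powr_mono) auto
    also have "\<dots> = real (2 ^ card (layer s))" by (simp add: powr_realpow)
    finally show ?thesis using le by (rule order_trans)
  qed
  then show ?thesis
    unfolding k_def[symmetric] using growth_pos[of k] by blast
qed

end
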